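(* Let $N,K$ be integers with $1\le N\le\left\lceil\frac{K+1}{2}\right\rceil$. For the $(N,K)$ cache network, the exact rate memory tradeoff is given by $$R^{*}(M)=\frac{K^{2}+K-2}{K(K-1)}-\frac{K+1}{N(K-1)}M,$$ where $$M\ \ge\ \frac{N}{K}(K-2).$$
   Context: The $(N,K)$ cache network ($1\le N\le K$): a server holds $N$ files and is connected by an error-free broadcast link to $K$ users $U_1,\dots,U_K$, each with its own cache of size $M\in[0,N]$. Write $[L]=\{1,\dots,L\}$. Scheme. Fix real numbers $M\in[0,N]$, $R\ge 0$. A caching scheme with cache size $M$ and rate $R$ consists of a positive integer $F$ (file size in bits) and the following. The files $W_1,\dots,W_N$ are independent and uniformly distributed on $\{0,1\}^F$. For each $k\in[K]$ the cache content $Z_k$ of user $U_k$ is a deterministic function of $(W_1,\dots,W_N)$ consisting of at most $MF$ bits. A demand is $\mathbf d=(d(1),\dots,d(K))\in[N]^K$, meaning that $U_k$ requests $W_{d(k)}$. $\mathbf D$ is the set of demands in which each of the $N$ files is requested by at least one user. For each $\mathbf d\in\mathbf D$ the broadcast $X_{\mathbf d}$ is a deterministic function of $(W_1,\dots,W_N)$ consisting of at most $RF$ bits, such that for every $k\in[K]$ the file $W_{d(k)}$ is determined by $(Z_k,X_{\mathbf d})$. (The caches do not depend on the demand.) Entropy $H$ is Shannon entropy in bits divided by $F$, so $H(W_n)=1$. Symmetric scheme. A scheme is symmetric if for all permutations $\pi$ of $[K]$ and $\sigma$ of $[N]$ and all $A\subseteq[N]$, $B\subseteq[K]$, $E\subseteq\mathbf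 D$, $$H\big((W_n)_{n\in A},(Z_k)_{k\in B},(X_{\mathbf d})_{\mathbf d\in E}\big)=H\big((W_{\sigma(n)})_{n\in A},(Z_{\pi(k)})_{k\in B},(X_{\sigma\circ\mathbf d\circ\pi^{-1}})_{\mathbf d\in E}\big).$$ Throughout, only symmetric schemes are considered: a pair $(M,R)$ is achievable if there is (for some $F$) a symmetric scheme with cache size $M$ and rate $R$. The exact rate memory tradeoff is $R^*(M)=\min\{R:(M,R)\text{ is achievable}\}$.
   Formalization: Restricted to 2≤N≤⌊(K+1)/2⌋ and M≤N(K-1)/K, since the formula fails for N=1, for K even with N=K/2+1, and for larger M; R*(M) is taken as an infimum, shown to be attained for rational M, since for irrational M no minimum exists. *)

theory Defs
  imports "HOL-Probability.Information" "HOL-Combinatorics.Permutations"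
begin

(* A library is a tuple of N files of F bits, W n being the file with index n in {1..N}.
   A cache or a broadcast is a function of the library, of type "files => bool list". *)
type_synonym files = "nat \<Rightarrow> bool list"

type_synonym demand = "nat \<Rightarrow> nat"

definition libraries :: "nat \<Rightarrow> nat \<Rightarrow> files set" where
  "libraries N F = {1..N} \<rightarrow>\<^sub>E {bs. length bs = F}"

(* Uniform on the product set: the N files are independent and uniform. *)
definition library_measure :: "nat \<Rightarrow> nat \<Rightarrow> files measure" where
  "library_measure N F = uniform_count_measure (libraries N F)"

definition demands :: "nat \<Rightarrow> nat \<Rightarrow> demand set" where
  "demands N K = {d \<in> {1..K} \<rightarrow>\<^sub>E {1..N}. d ` {1..K} = {1..N}}"

(* A string of at most b bits is a bit string of one fixed length m with m \<le> b.  The length must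
   not depend on the library: a varying length would itself carry information. *)
definition bits_at_most :: "nat \<Rightarrow> nat \<Rightarrow> real \<Rightarrow> (files \<Rightarrow> bool list) \<Rightarrow> bool" where
  "bits_at_most N F b Y \<longleftrightarrow> (\<exists>m::nat. real m \<le> b \<and> (\<forall>W \<in> libraries N F. length (Y W) = m))"

definition caching_scheme ::
  "nat \<Rightarrow> nat \<Rightarrow> real \<Rightarrow> real \<Rightarrow> nat \<Rightarrow> (nat \<Rightarrow> files \<Rightarrow> bool list) \<Rightarrow>
   (demand \<Rightarrow> files \<Rightarrow> bool list) \<Rightarrow> bool" where
  "caching_scheme N K M R F Z X \<longleftrightarrow>
     0 < F \<and>
     (\<forall>k \<in> {1..K}. bits_at_most N F (M * real F) (Z k)) \<and>
     (\<forall>d \<in> demands N K. bits_at_most N F (R * real F) (X d)) \<and>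
     (\<forall>d \<in> demands N K. \<forall>k \<in> {1..K}.
        \<exists>\<psi>. \<forall>W \<in> libraries N F. \<psi> (Z k W) (X d W) = W (d k))"

(* Shannon entropy, in units of F bits, of a random variable Y on the space of libraries. *)
definition normalized_entropy :: "nat \<Rightarrow> nat \<Rightarrow> (files \<Rightarrow> 'a) \<Rightarrow> real" where
  "normalized_entropy N F Y =
     prob_space.entropy (library_measure N F) 2 (count_space (Y ` libraries N F)) Y / real F"

(* Outside {1..K} the composition need not be undefined, hence the restriction. *)
definition permute_demand ::
  "nat \<Rightarrow> (nat \<Rightarrow> nat) \<Rightarrow> (nat \<Rightarrow> nat) \<Rightarrow> demand \<Rightarrow> demand" where
  "permute_demand K \<sigma> \<pi> d = restrict (\<sigma> \<circ> d \<circ> inv \<pi>) {1..K}"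

definition symmetric_scheme ::
  "nat \<Rightarrow> nat \<Rightarrow> nat \<Rightarrow> (nat \<Rightarrow> files \<Rightarrow> bool list) \<Rightarrow> (demand \<Rightarrow> files \<Rightarrow> bool list) \<Rightarrow> bool" where
  "symmetric_scheme N K F Z X \<longleftrightarrow>
     (\<forall>\<pi> \<sigma> A B E. \<pi> permutes {1..K} \<longrightarrow> \<sigma> permutes {1..N} \<longrightarrow>
        A \<subseteq> {1..N} \<longrightarrow> B \<subseteq> {1..K} \<longrightarrow> E \<subseteq> demands N K \<longrightarrow>
        normalized_entropy N F
          (\<lambda>W. (\<lambda>n\<in>A. W n, \<lambda>k\<in>B. Z k W, \<lambda>d\<in>E. X d W)) =
        normalized_entropy N F
          (\<lambda>W. (\<lambda>n\<in>A. W (\<sigma> n), \<lambda>k\<in>B. Z (\<pi> k) W, \<lambda>d\<in>E. X (permute_demand K \<sigma> \<pi> d) W)))"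

definition achievable :: "nat \<Rightarrow> nat \<Rightarrow> real \<Rightarrow> real \<Rightarrow> bool" where
  "achievable N K M R \<longleftrightarrow>
     0 \<le> M \<and> M \<le> real N \<and> 0 \<le> R \<and>
     (\<exists>F Z X. caching_scheme N K M R F Z X \<and> symmetric_scheme N K F Z X)"

(* The minimal achievable rate, wherever a minimum exists.  It is an infimum in general: a cache
   holds a whole number of bits, at most \<lfloor>M F\<rfloor>, so for irrational M the cache size M is only
   approached as F grows. *)
definition exact_rate :: "nat \<Rightarrow> nat \<Rightarrow> real \<Rightarrow> real" where
  "exact_rate N K M = Inf {R. achievable N K M R}"

end

theory Submission
  imports Defs
begin

text \<open>Lower bound: let \<open>W'\<close> be the files other than \<open>N\<close>, and let \<open>D j\<close> be a demand in which
  user \<open>j\<close> alone asks for file \<open>N\<close>.  Given \<open>W'\<close>, the broadcasts for \<open>D 1, \<dots>, D K\<close> have entropy at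
  most \<open>1\<close>.  On the other hand, since cache \<open>j\<close> and the broadcast for \<open>D j\<close> determine everything,
  adding the \<open>j\<close>-th broadcast to the previous ones contributes, by submodularity, at least
  \<open>N - H(W', Z j, X (D 1), \<dots>, X (D (j - 1)))\<close>, which is at least
  \<open>N - H(W', Z j) - (j - 1) e\<close> for any bound \<open>e\<close> on the entropy of a broadcast given \<open>W'\<close> and
  the cache of a user not asking for \<open>N\<close>.  As the entropy of \<open>a\<close> files and one cache depends on
  \<open>a\<close> only, by symmetry, \<open>e = R + (H(Z 1) - H(W', Z 1)) / (N - 1)\<close> will do.  The resulting
  inequality is monotone in \<open>H(W', Z 1)\<close> when \<open>2 N \<le> K + 1\<close>, and inserting
  \<open>H(W', Z 1) \<ge> N - 1 + H(Z 1) / N\<close> gives the bound.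

  Upper bound: memory sharing between the Maddah-Ali--Niesen schemes in which each piece of a
  file is missing from one cache, respectively from two caches.\<close>

section \<open>Entropy on a finite uniform space\<close>

text \<open>Shannon entropy in bits under the uniform law: the value \<open>Y w\<close> has
  probability fibre size over \<open>card \<Omega>\<close>. Only the partition of
  \<open>\<Omega>\<close> into fibres matters, so entropy inequalities become comparisons of fibre
  sizes.\<close>

definition unif_entropy :: "'w set \<Rightarrow> ('w \<Rightarrow> 'a) \<Rightarrow> real" where
  "unif_entropy \<Omega> Y =
     log 2 (card \<Omega>) - (\<Sum>w\<in>\<Omega>. log 2 (card {v\<in>\<Omega>. Y v = Y w})) / card \<Omega>"

lemma card_fibre_pos: "finite \<Omega> \<Longrightarrow> w \<in> \<Omega> \<Longrightarrow> 0 < card {v\<in>\<Omega>. Y v = Y w}"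
  by (subst card_gt_0_iff) auto

lemma sum_inverse_card_fibre:
  assumes "finite \<Omega>"
  shows "(\<Sum>w\<in>\<Omega>. 1 / real (card {v\<in>\<Omega>. Y v = Y w})) = card (Y ` \<Omega>)"
proof -
  have "(\<Sum>w\<in>\<Omega>. 1 / real (card {v\<in>\<Omega>. Y v = Y w})) =
      (\<Sum>y\<in>Y ` \<Omega>. \<Sum>w\<in>{w\<in>\<Omega>. Y w = y}. 1 / real (card {v\<in>\<Omega>. Y v = Y w}))"
    by (rule sum.image_gen[OF assms])
  also have "\<dots> = (\<Sum>y\<in>Y ` \<Omega>. 1)"
  proof (rule sum.cong[OF refl])
    fix y assume "y \<in> Y ` \<Omega>"
    then have "card {w\<in>\<Omega>. Y w = y} > 0"
      using assms card_gt_0_iff by fastforce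
    moreover have "(\<Sum>w\<in>{w\<in>\<Omega>. Y w = y}. 1 / real (card {v\<in>\<Omega>. Y v = Y w})) =
        (\<Sum>w\<in>{w\<in>\<Omega>. Y w = y}. 1 / real (card {w\<in>\<Omega>. Y w = y}))"
      by (rule sum.cong) auto
    ultimately show "(\<Sum>w\<in>{w\<in>\<Omega>. Y w = y}. 1 / real (card {v\<in>\<Omega>. Y v = Y w})) = 1"
      by simp
  qed
  finally show ?thesis by simp
qed

text \<open>Jensen's inequality for the logarithm, by \<open>ln u \<le> u - 1\<close>. The
  cardinality bound and submodularity both apply it to ratios of fibre sizes.\<close>

lemma sum_log_nonpos:
  fixes u :: "'w \<Rightarrow> real"
  assumes "\<And>w. w \<in> \<Omega> \<Longrightarrow> 0 < u w" and "sum u \<Omega> \<le> card \<Omega>"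
  shows "(\<Sum>w\<in>\<Omega>. log 2 (u w)) \<le> 0"
proof -
  have "(\<Sum>w\<in>\<Omega>. ln (u w)) \<le> (\<Sum>w\<in>\<Omega>. u w - 1)"
    by (intro sum_mono ln_le_minus_one assms)
  also have "\<dots> \<le> 0"
    using assms(2) by (simp add: sum_subtractf)
  finally show ?thesis
    by (simp add: log_def divide_nonpos_pos flip: sum_divide_distrib)
qed

text \<open>Each \<open>Q\<close>-fibre lies inside the \<open>P\<close>-fibre of the same
  point.\<close>

lemma unif_entropy_mono:
  assumes "finite \<Omega>"
    and det: "\<And>v w. v \<in> \<Omega> \<Longrightarrow> w \<in> \<Omega> \<Longrightarrow> Q v = Q w \<Longrightarrow> P v = P w"
  shows "unif_entropy \<Omega> P \<le> unif_entropy \<Omega> Q"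
proof -
  have "log 2 (card {v\<in>\<Omega>. Q v = Q w}) \<le> log 2 (card {v\<in>\<Omega>. P v = P w})" if "w \<in> \<Omega>" for w
  proof -
    have "card {v\<in>\<Omega>. Q v = Q w} \<le> card {v\<in>\<Omega>. P v = P w}"
      using assms(1) that by (intro card_mono) (auto intro: det)
    then show ?thesis
      using card_fibre_pos[OF assms(1) that, of Q] by simp
  qed
  then show ?thesis
    unfolding unif_entropy_def
    by (intro diff_left_mono divide_right_mono sum_mono) auto
qed

lemma unif_entropy_cong:
  assumes "finite \<Omega>"
    and "\<And>v w. v \<in> \<Omega> \<Longrightarrow> w \<in> \<Omega> \<Longrightarrow> Q v = Q w \<longleftrightarrow> P v = P w"
  shows "unif_entropy \<Omega> P = unif_entropy \<Omega> Q"
  using assms by (intro antisym unif_entropy_mono) simp_all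

text \<open>\<open>\<Phi>\<close> carries each \<open>Q\<close>-fibre onto a \<open>P\<close>-fibre,
  so reindexing along \<open>\<Phi>\<close> matches the sums of logarithms.\<close>

lemma unif_entropy_bij:
  assumes "finite \<Omega>" and bij: "bij_betw \<Phi> \<Omega> \<Omega>"
    and ker: "\<And>v w. v \<in> \<Omega> \<Longrightarrow> w \<in> \<Omega> \<Longrightarrow> P (\<Phi> v) = P (\<Phi> w) \<longleftrightarrow> Q v = Q w"
  shows "unif_entropy \<Omega> P = unif_entropy \<Omega> Q"
proof -
  have "card {v\<in>\<Omega>. P v = P (\<Phi> w)} = card {v\<in>\<Omega>. Q v = Q w}" if "w \<in> \<Omega>" for w
  proof -
    have surj: "\<Phi> ` \<Omega> = \<Omega>" and inj: "inj_on \<Phi> \<Omega>"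
      using bij by (auto simp: bij_betw_def)
    have "{v\<in>\<Omega>. P v = P (\<Phi> w)} = \<Phi> ` {v\<in>\<Omega>. Q v = Q w}"
    proof (intro equalityI subsetI)
      fix x assume "x \<in> {v\<in>\<Omega>. P v = P (\<Phi> w)}"
      moreover from this have "x \<in> \<Phi> ` \<Omega>"
        using surj by simp
      ultimately obtain v where "v \<in> \<Omega>" "x = \<Phi> v" "P (\<Phi> v) = P (\<Phi> w)"
        by auto
      then show "x \<in> \<Phi> ` {v\<in>\<Omega>. Q v = Q w}"
        using ker[of v w] that by simp
    next
      fix x assume "x \<in> \<Phi> ` {v\<in>\<Omega>. Q v = Q w}"
      then obtain v where "v \<in> \<Omega>" "x = \<Phi> v" "Q v = Q w"
        by auto
      then show "x \<in> {v\<in>\<Omega>. P v = P (\<Phi> w)}"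
        using ker[of v w] that surj by auto
    qed
    moreover have "inj_on \<Phi> {v\<in>\<Omega>. Q v = Q w}"
      by (rule inj_on_subset[OF inj]) auto
    ultimately show ?thesis
      by (simp add: card_image)
  qed
  then have "(\<Sum>w\<in>\<Omega>. log 2 (card {v\<in>\<Omega>. P v = P w})) = (\<Sum>w\<in>\<Omega>. log 2 (card {v\<in>\<Omega>. Q v = Q w}))"
    by (subst sum.reindex_bij_betw[OF bij, symmetric]) simp
  then show ?thesis
    by (simp add: unif_entropy_def)
qed

lemma unif_entropy_inj:
  assumes "inj_on Y \<Omega>"
  shows "unif_entropy \<Omega> Y = log 2 (card \<Omega>)"
proof -
  have "{v\<in>\<Omega>. Y v = Y w} = {w}" if "w \<in> \<Omega>" for w
    using assms that by (auto simp: inj_on_def)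
  then show ?thesis
    by (simp add: unif_entropy_def)
qed

lemma unif_entropy_const:
  assumes "finite \<Omega>" and "\<Omega> \<noteq> {}"
  shows "unif_entropy \<Omega> (\<lambda>_. c) = 0"
  using assms by (simp add: unif_entropy_def)

text \<open>Jensen for \<open>?n / (?c w * C)\<close>: the inverse fibre sizes add up to the number
  of values, which is at most \<open>C\<close>.\<close>

lemma unif_entropy_le_card:
  assumes "finite \<Omega>" and "\<Omega> \<noteq> {}" and "card (Y ` \<Omega>) \<le> C"
  shows "unif_entropy \<Omega> Y \<le> log 2 C"
proof -
  let ?c = "\<lambda>w. real (card {v\<in>\<Omega>. Y v = Y w})"
  let ?n = "real (card \<Omega>)"
  have n: "?n > 0" using assms by (simp add: card_gt_0_iff)
  have "card (Y ` \<Omega>) > 0" using assms by (simp add: card_gt_0_iff)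
  then have C: "real C > 0" using assms(3) by simp
  have c: "?c w > 0" if "w \<in> \<Omega>" for w
    using card_fibre_pos[OF assms(1) that, of Y] by simp
  have "(\<Sum>w\<in>\<Omega>. ?n / (?c w * C)) = ?n / C * (\<Sum>w\<in>\<Omega>. 1 / ?c w)"
    by (simp add: sum_distrib_left field_simps)
  also have "\<dots> \<le> ?n"
    using n C assms(3) by (simp add: sum_inverse_card_fibre[OF assms(1)] field_simps)
  finally have "(\<Sum>w\<in>\<Omega>. log 2 (?n / (?c w * C))) \<le> 0"
    using n C c by (intro sum_log_nonpos) auto
  moreover have "(\<Sum>w\<in>\<Omega>. log 2 (?n / (?c w * C))) = (\<Sum>w\<in>\<Omega>. log 2 ?n - log 2 (?c w) - log 2 C)"
    using n C c by (intro sum.cong refl) (simp add: log_divide log_mult)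
  ultimately have "?n * log 2 ?n - (\<Sum>w\<in>\<Omega>. log 2 (?c w)) \<le> ?n * log 2 C"
    by (simp add: sum_subtractf)
  then have "log 2 ?n - (\<Sum>w\<in>\<Omega>. log 2 (?c w)) / ?n \<le> log 2 C"
    using n by (simp add: field_simps)
  then show ?thesis
    by (simp add: unif_entropy_def)
qed

text \<open>Submodularity, with the joint and the common part given only through what determines
  them.\<close>

lemma unif_entropy_submodular:
  assumes fin: "finite \<Omega>"
    and J: "\<And>v w. v \<in> \<Omega> \<Longrightarrow> w \<in> \<Omega> \<Longrightarrow> P v = P w \<Longrightarrow> Q v = Q w \<Longrightarrow> J v = J w"
    and IP: "\<And>v w. v \<in> \<Omega> \<Longrightarrow> w \<in> \<Omega> \<Longrightarrow> P v = P w \<Longrightarrow> I v = I w"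
    and IQ: "\<And>v w. v \<in> \<Omega> \<Longrightarrow> w \<in> \<Omega> \<Longrightarrow> Q v = Q w \<Longrightarrow> I v = I w"
  shows "unif_entropy \<Omega> J + unif_entropy \<Omega> I \<le> unif_entropy \<Omega> P + unif_entropy \<Omega> Q"
proof -
  define cP where "cP w = real (card {v\<in>\<Omega>. P v = P w})" for w
  define cQ where "cQ w = real (card {v\<in>\<Omega>. Q v = Q w})" for w
  define cJ where "cJ w = real (card {v\<in>\<Omega>. J v = J w})" for w
  define cI where "cI w = real (card {v\<in>\<Omega>. I v = I w})" for w
  have pos: "cP w > 0" "cQ w > 0" "cJ w > 0" "cI w > 0" if "w \<in> \<Omega>" for w
    unfolding cP_def cQ_def cJ_def cI_def
    using card_fibre_pos[OF fin that] by simp_all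
  \<comment> \<open>The product of the two fibre sizes counts pairs of a point \<open>a\<close> in
    the \<open>P\<close>-fibre and a point \<open>b\<close> in the \<open>Q\<close>-fibre of
    \<open>w\<close>.\<close>
  have pairs: "cP w * cQ w = (\<Sum>a\<in>\<Omega>. \<Sum>b\<in>\<Omega>. of_bool (P a = P w \<and> Q b = Q w))" for w
  proof -
    have "(\<Sum>a\<in>\<Omega>. of_bool (P a = P w)) = cP w" "(\<Sum>b\<in>\<Omega>. of_bool (Q b = Q w)) = cQ w"
      using fin by (simp_all add: cP_def cQ_def Int_def)
    then show ?thesis
      unfolding of_bool_conj sum_product[symmetric] by simp
  qed
  \<comment> \<open>All \<open>w\<close> compatible with a given pair lie in one
    \<open>J\<close>-fibre, so there are at most \<open>cJ w\<close> of them; \<open>I\<close> takes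
    the same value on them as on \<open>a\<close> and \<open>b\<close>, so they exist only if
    \<open>I b = I a\<close>.\<close>
  have bound: "(\<Sum>w\<in>\<Omega>. of_bool (P a = P w \<and> Q b = Q w) / (cJ w * cI w)) \<le> of_bool (I b = I a) / cI a"
    if a: "a \<in> \<Omega>" and b: "b \<in> \<Omega>" for a b
  proof -
    define T where "T = {w\<in>\<Omega>. P a = P w \<and> Q b = Q w}"
    have "(\<Sum>w\<in>\<Omega>. of_bool (P a = P w \<and> Q b = Q w) / (cJ w * cI w)) = (\<Sum>w\<in>T. 1 / (cJ w * cI w))"
      unfolding T_def using fin by (subst sum.inter_filter) (auto intro!: sum.cong)
    also have "\<dots> \<le> of_bool (I b = I a) / cI a"
    proof (cases "T = {}")
      case True
      show ?thesis
        unfolding True using pos(4)[OF a] by simp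
    next
      case False
      then have Tpos: "real (card T) > 0" using fin by (simp add: card_gt_0_iff T_def)
      have Iab: "I b = I a"
        proof -
        from False obtain w where "w \<in> \<Omega>" "P a = P w" "Q b = Q w"
          by (auto simp: T_def)
        then show ?thesis using IP[OF a] IQ[OF b] by metis
      qed
      have "1 / (cJ w * cI w) \<le> 1 / (real (card T) * cI a)" if w: "w \<in> T" for w
      proof -
        have "I v = I w \<longleftrightarrow> I v = I a" for v
          using IP[OF a, of w] w by (auto simp: T_def)
        then have "cI w = cI a"
          by (simp add: cI_def)
        moreover have "card T \<le> card {v\<in>\<Omega>. J v = J w}"
          using fin w by (intro card_mono) (auto simp: T_def intro!: J)
        ultimately show ?thesis
          using Tpos pos(4)[OF a] by (intro divide_left_mono mult_mono mult_pos_pos) (auto simp: cJ_def)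
      qed
      then have "(\<Sum>w\<in>T. 1 / (cJ w * cI w)) \<le> (\<Sum>w\<in>T. 1 / (real (card T) * cI a))"
        by (rule sum_mono)
      then show ?thesis
        using Tpos Iab by simp
    qed
    finally show ?thesis .
  qed
  \<comment> \<open>The ratios sum to at most \<open>card \<Omega>\<close>: after exchanging sums,
    the points \<open>b\<close> in the \<open>I\<close>-fibre of \<open>a\<close> contribute
    \<open>cI a\<close> times \<open>1 / cI a\<close>.\<close>
  have "(\<Sum>w\<in>\<Omega>. cP w * cQ w / (cJ w * cI w)) =
      (\<Sum>w\<in>\<Omega>. \<Sum>a\<in>\<Omega>. \<Sum>b\<in>\<Omega>. of_bool (P a = P w \<and> Q b = Q w) / (cJ w * cI w))"
    unfolding pairs by (simp add: sum_divide_distrib)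
  also have "\<dots> = (\<Sum>a\<in>\<Omega>. \<Sum>w\<in>\<Omega>. \<Sum>b\<in>\<Omega>. of_bool (P a = P w \<and> Q b = Q w) / (cJ w * cI w))"
    by (rule sum.swap)
  also have "\<dots> = (\<Sum>a\<in>\<Omega>. \<Sum>b\<in>\<Omega>. \<Sum>w\<in>\<Omega>. of_bool (P a = P w \<and> Q b = Q w) / (cJ w * cI w))"
    by (intro sum.cong refl sum.swap)
  also have "\<dots> \<le> (\<Sum>a\<in>\<Omega>. \<Sum>b\<in>\<Omega>. of_bool (I b = I a) / cI a)"
    by (intro sum_mono bound)
  also have "\<dots> = (\<Sum>a\<in>\<Omega>. 1)"
  proof (rule sum.cong[OF refl])
    fix a assume a: "a \<in> \<Omega>"
    have "(\<Sum>b\<in>\<Omega>. of_bool (I b = I a) / cI a) = (\<Sum>b\<in>\<Omega>. of_bool (I b = I a)) / cI a"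
      by (simp add: sum_divide_distrib)
    also have "(\<Sum>b\<in>\<Omega>. of_bool (I b = I a)) = cI a"
      using fin by (simp add: cI_def Int_def)
    finally show "(\<Sum>b\<in>\<Omega>. of_bool (I b = I a) / cI a) = 1"
      using pos(4)[OF a] by simp
  qed
  finally have "(\<Sum>w\<in>\<Omega>. log 2 (cP w * cQ w / (cJ w * cI w))) \<le> 0"
    using pos by (intro sum_log_nonpos) auto
  moreover have "(\<Sum>w\<in>\<Omega>. log 2 (cP w * cQ w / (cJ w * cI w))) =
      (\<Sum>w\<in>\<Omega>. log 2 (cP w) + log 2 (cQ w) - (log 2 (cJ w) + log 2 (cI w)))"
  proof (rule sum.cong[OF refl])
    fix w assume "w \<in> \<Omega>"
    then show "log 2 (cP w * cQ w / (cJ w * cI w)) =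
        log 2 (cP w) + log 2 (cQ w) - (log 2 (cJ w) + log 2 (cI w))"
      using pos[of w] by (simp add: log_divide log_mult)
  qed
  ultimately have "(\<Sum>w\<in>\<Omega>. log 2 (cP w)) + (\<Sum>w\<in>\<Omega>. log 2 (cQ w)) \<le>
      (\<Sum>w\<in>\<Omega>. log 2 (cJ w)) + (\<Sum>w\<in>\<Omega>. log 2 (cI w))"
    by (simp add: sum_subtractf sum.distrib)
  then have "(\<Sum>w\<in>\<Omega>. log 2 (cP w)) / card \<Omega> + (\<Sum>w\<in>\<Omega>. log 2 (cQ w)) / card \<Omega> \<le>
      (\<Sum>w\<in>\<Omega>. log 2 (cJ w)) / card \<Omega> + (\<Sum>w\<in>\<Omega>. log 2 (cI w)) / card \<Omega>"
    by (simp add: divide_right_mono flip: add_divide_distrib)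
  then show ?thesis
    unfolding unif_entropy_def cP_def cQ_def cJ_def cI_def by linarith
qed

text \<open>Reduces the measure-theoretic entropy of the definitions to counting fibres.\<close>

lemma entropy_uniform_count_measure:
  assumes fin: "finite \<Omega>" and ne: "\<Omega> \<noteq> {}"
  shows "prob_space.entropy (uniform_count_measure \<Omega>) 2 (count_space (Y ` \<Omega>)) Y =
    unif_entropy \<Omega> Y"
proof -
  let ?M = "uniform_count_measure \<Omega>"
  let ?n = "real (card \<Omega>)"
  interpret prob_space ?M
    by (rule prob_space_uniform_count_measure[OF fin ne])
  interpret information_space ?M 2
    by standard simp
  have n: "?n > 0" using fin ne by (simp add: card_gt_0_iff)
  have sp: "space ?M = \<Omega>" by (simp add: space_uniform_count_measure)
  have Y: "simple_function ?M Y"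
    using fin by (auto simp: simple_function_def sp sets_uniform_count_measure)
  have meas: "measure ?M (Y -` {y} \<inter> space ?M) = card {v\<in>\<Omega>. Y v = y} / ?n" for y
  proof -
    have "Y -` {y} \<inter> \<Omega> = {v\<in>\<Omega>. Y v = y}" by auto
    then show ?thesis
      using fin by (simp add: sp measure_uniform_count_measure)
  qed
  have "simple_distributed ?M Y (\<lambda>y. card {v\<in>\<Omega>. Y v = y} / ?n)"
    using Y meas by (intro simple_distributedI) auto
  then have "entropy 2 (count_space (Y ` \<Omega>)) Y = - (\<Sum>y\<in>Y ` \<Omega>. card {v\<in>\<Omega>. Y v = y} / ?n * log 2 (card {v\<in>\<Omega>. Y v = y} / ?n))"
    by (rule entropy_simple_distributed[unfolded sp])
  \<comment> \<open>The term of a value \<open>y\<close> is spread evenly over the points of its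
    fibre.\<close>
  also have "(\<Sum>y\<in>Y ` \<Omega>. card {v\<in>\<Omega>. Y v = y} / ?n * log 2 (card {v\<in>\<Omega>. Y v = y} / ?n)) =
      (\<Sum>y\<in>Y ` \<Omega>. \<Sum>w\<in>{w\<in>\<Omega>. Y w = y}. log 2 (card {v\<in>\<Omega>. Y v = Y w} / ?n) / ?n)"
    by (intro sum.cong refl) simp
  also have "\<dots> = (\<Sum>w\<in>\<Omega>. log 2 (card {v\<in>\<Omega>. Y v = Y w} / ?n) / ?n)"
    by (rule sum.image_gen[OF fin, symmetric])
  also have "\<dots> = (\<Sum>w\<in>\<Omega>. log 2 (card {v\<in>\<Omega>. Y v = Y w}) / ?n - log 2 ?n / ?n)"
  proof (rule sum.cong[OF refl])
    fix w assume "w \<in> \<Omega>"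
    then show "log 2 (card {v\<in>\<Omega>. Y v = Y w} / ?n) / ?n =
        log 2 (card {v\<in>\<Omega>. Y v = Y w}) / ?n - log 2 ?n / ?n"
      using n card_fibre_pos[OF fin, of w Y] by (simp add: log_divide diff_divide_distrib)
  qed
  also have "\<dots> = (\<Sum>w\<in>\<Omega>. log 2 (card {v\<in>\<Omega>. Y v = Y w})) / ?n - log 2 ?n"
    using n by (simp add: sum_subtractf sum_divide_distrib)
  finally show ?thesis
    by (simp add: unif_entropy_def sp)
qed

section \<open>Lower bound on the rate\<close>

lemma finite_libraries: "finite (libraries N F)"
  unfolding libraries_def by (intro finite_PiE) (auto simp: finite_list_length)

lemma card_libraries: "card (libraries N F) = 2 ^ (N * F)"
  using card_lists_length_eq[of "UNIV :: bool set" F]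
  by (simp add: libraries_def card_PiE power_mult mult.commute)

lemma libraries_nonempty: "libraries N F \<noteq> {}"
  using card_libraries[of N F] by fastforce

lemma libraries_eqI:
  assumes "v \<in> libraries N F" "w \<in> libraries N F" "\<And>n. n \<in> {1..N} \<Longrightarrow> v n = w n"
  shows "v = w"
  using assms unfolding libraries_def by (rule PiE_ext)

lemma normalized_entropy_eq:
  "normalized_entropy N F Y = unif_entropy (libraries N F) Y / real F"
  unfolding normalized_entropy_def library_measure_def
  by (simp add: entropy_uniform_count_measure[OF finite_libraries libraries_nonempty])

lemma restrict_eq_iff: "restrict f A = restrict g A \<longleftrightarrow> (\<forall>x\<in>A. f x = g x)"
  by (metis restrict_apply' restrict_ext)

text \<open>Glues a bijection from \<open>A\<close> to \<open>B\<close> with one between the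
  complements, since symmetry speaks of permutations of the whole index set.\<close>

lemma exists_permutes_image:
  assumes "finite S" "A \<subseteq> S" "B \<subseteq> S" "card A = card B"
  obtains \<sigma> where "\<sigma> permutes S" "\<sigma> ` A = B"
proof -
  have fin: "finite A" "finite B" using assms finite_subset by blast+
  obtain f where f: "bij_betw f A B"
    using fin assms(4) by (meson finite_same_card_bij)
  have "card (S - A) = card (S - B)"
    using assms fin by (simp add: card_Diff_subset)
  then obtain g where g: "bij_betw g (S - A) (S - B)"
    using assms(1) by (meson finite_Diff finite_same_card_bij)
  define \<sigma> where "\<sigma> x = (if x \<in> A then f x else if x \<in> S then g x else x)" for x
  have fA: "bij_betw \<sigma> A B"
    using f by (rule bij_betw_cong[THEN iffD1, rotated]) (simp add: \<sigma>_def)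
  have "bij_betw \<sigma> (S - A) (S - B)"
    using g by (rule bij_betw_cong[THEN iffD1, rotated]) (simp add: \<sigma>_def)
  with fA have "bij_betw \<sigma> (A \<union> (S - A)) (B \<union> (S - B))"
    by (rule bij_betw_combine) auto
  moreover have "A \<union> (S - A) = S" "B \<union> (S - B) = S"
    using assms by auto
  ultimately have "\<sigma> permutes S"
    using assms(2) by (intro bij_imp_permutes) (auto simp: \<sigma>_def)
  moreover have "\<sigma> ` A = B"
    using fA by (simp add: bij_betw_def)
  ultimately show ?thesis using that by blast
qed

lemma exists_demand_only:
  assumes "2 \<le> N" "N \<le> K" "j \<in> {1..K}"
  shows "\<exists>d \<in> demands N K. d j = N \<and> (\<forall>k\<in>{1..K}. k \<noteq> j \<longrightarrow> d k \<in> {1..<N})"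
proof -
  \<comment> \<open>The users other than \<open>j\<close> are numbered consecutively, skipping
    \<open>j\<close>; the first \<open>N - 1\<close> of them ask for files \<open>1\<close> to
    \<open>N - 1\<close> in order and the rest repeat file \<open>N - 1\<close>.\<close>
  define d where "d = (\<lambda>k\<in>{1..K}. if k = j then N else min (if k < j then k else k - 1) (N - 1))"
  have range: "d k \<in> {1..<N}" if "k \<in> {1..K}" "k \<noteq> j" for k
    using that assms by (auto simp: d_def)
  have dj: "d j = N"
    using assms by (simp add: d_def)
  have "n \<in> d ` {1..K}" if n: "n \<in> {1..N}" for n
  proof (cases "n = N")
    case True
    then show ?thesis using dj assms(3) by blast
  next
    case False
    define k where "k = (if n < j then n else n + 1)"
    have "k \<in> {1..K}" "d k = n"
      using False n assms by (auto simp: k_def d_def)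
    then show ?thesis by blast
  qed
  moreover have "d k \<in> {1..N}" if "k \<in> {1..K}" for k
    using range[OF that] dj assms by (cases "k = j") auto
  ultimately have "d ` {1..K} = {1..N}"
    by blast
  moreover have "d \<in> extensional {1..K}"
    by (simp add: d_def)
  ultimately have "d \<in> demands N K"
    unfolding demands_def PiE_def by auto
  then show ?thesis
    using dj range by blast
qed

section \<open>Entropies of the files, caches and broadcasts of a scheme\<close>

locale caching =
  fixes N K :: nat and M R :: real and F :: nat
    and Z :: "nat \<Rightarrow> files \<Rightarrow> bool list" and X :: "demand \<Rightarrow> files \<Rightarrow> bool list"
  assumes scheme: "caching_scheme N K M R F Z X"
begin

text \<open>The same tuple as in \<open>symmetric_scheme\<close>, so that symmetry becomes an
  equation between values of \<open>H\<close>.\<close>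

definition observation ::
  "nat set \<Rightarrow> nat set \<Rightarrow> demand set \<Rightarrow> files \<Rightarrow>
     (nat \<Rightarrow> bool list) \<times> (nat \<Rightarrow> bool list) \<times> (demand \<Rightarrow> bool list)" where
  "observation A B E W = (\<lambda>n\<in>A. W n, \<lambda>k\<in>B. Z k W, \<lambda>d\<in>E. X d W)"

definition H :: "nat set \<Rightarrow> nat set \<Rightarrow> demand set \<Rightarrow> real" where
  "H A B E = normalized_entropy N F (observation A B E)"

lemma observation_eq_iff:
  "observation A B E v = observation A B E w \<longleftrightarrow>
     (\<forall>n\<in>A. v n = w n) \<and> (\<forall>k\<in>B. Z k v = Z k w) \<and> (\<forall>d\<in>E. X d v = X d w)"
  by (simp add: observation_def restrict_eq_iff)

lemma F_pos: "0 < real F"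
  using scheme by (simp add: caching_scheme_def)

lemma decode:
  assumes "d \<in> demands N K" "k \<in> {1..K}" "v \<in> libraries N F" "w \<in> libraries N F"
    and "Z k v = Z k w" "X d v = X d w"
  shows "v (d k) = w (d k)"
proof -
  obtain \<psi> where "\<forall>W \<in> libraries N F. \<psi> (Z k W) (X d W) = W (d k)"
    using scheme assms(1,2) unfolding caching_scheme_def by blast
  then show ?thesis
    using assms by metis
qed

lemma H_mono_determined:
  assumes "\<And>v w. v \<in> libraries N F \<Longrightarrow> w \<in> libraries N F \<Longrightarrow>
    observation A' B' E' v = observation A' B' E' w \<Longrightarrow> observation A B E v = observation A B E w"
  shows "H A B E \<le> H A' B' E'"
  unfolding H_def normalized_entropy_eq
  by (intro divide_right_mono unif_entropy_mono finite_libraries assms) auto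

text \<open>Submodularity with decoding built in: the joint term may contain any file that the two
  observations together determine.\<close>

lemma H_submodular_determined:
  assumes "\<And>v w. v \<in> libraries N F \<Longrightarrow> w \<in> libraries N F \<Longrightarrow>
      observation A1 B1 E1 v = observation A1 B1 E1 w \<Longrightarrow>
      observation A2 B2 E2 v = observation A2 B2 E2 w \<Longrightarrow>
      observation A3 B3 E3 v = observation A3 B3 E3 w"
    and sub: "A4 \<subseteq> A1 \<inter> A2" "B4 \<subseteq> B1 \<inter> B2" "E4 \<subseteq> E1 \<inter> E2"
  shows "H A3 B3 E3 + H A4 B4 E4 \<le> H A1 B1 E1 + H A2 B2 E2"
proof -
  have "unif_entropy (libraries N F) (observation A3 B3 E3) +
        unif_entropy (libraries N F) (observation A4 B4 E4)
     \<le> unif_entropy (libraries N F) (observation A1 B1 E1) +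
        unif_entropy (libraries N F) (observation A2 B2 E2)"
  proof (rule unif_entropy_submodular[OF finite_libraries])
    show "observation A4 B4 E4 v = observation A4 B4 E4 w"
      if "observation A1 B1 E1 v = observation A1 B1 E1 w" for v w
      using that sub by (simp add: observation_eq_iff subset_iff)
    show "observation A4 B4 E4 v = observation A4 B4 E4 w"
      if "observation A2 B2 E2 v = observation A2 B2 E2 w" for v w
      using that sub by (simp add: observation_eq_iff subset_iff)
  qed (rule assms(1))
  then show ?thesis
    using F_pos by (simp add: H_def normalized_entropy_eq divide_right_mono flip: add_divide_distrib)
qed

lemma H_submodular:
  "H (A1 \<union> A2) (B1 \<union> B2) (E1 \<union> E2) + H (A1 \<inter> A2) (B1 \<inter> B2) (E1 \<inter> E2) \<le> H A1 B1 E1 + H A2 B2 E2"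
  by (rule H_submodular_determined) (auto simp: observation_eq_iff)

text \<open>The files determine every cache and broadcast, and the library is uniform on
  \<open>2 ^ (N * F)\<close> points.\<close>

lemma H_all: "H {1..N} B E = real N"
proof -
  have "inj_on (observation {1..N} B E) (libraries N F)"
    by (rule inj_onI, rule libraries_eqI) (auto simp: observation_eq_iff)
  then show ?thesis
    using F_pos by (simp add: H_def normalized_entropy_eq unif_entropy_inj card_libraries log_nat_power)
qed

text \<open>Strings of one fixed length \<open>m\<close> take at most \<open>2 ^ m\<close> values.
  Files, caches and broadcasts are all instances of \<open>Y\<close>.\<close>

lemma H_le_length:
  fixes Y :: "files \<Rightarrow> bool list"
  assumes "\<And>W. W \<in> libraries N F \<Longrightarrow> length (Y W) = m"
    and "\<And>v w. Y v = Y w \<Longrightarrow> observation A B E v = observation A B E w"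
  shows "H A B E \<le> real m / real F"
proof -
  have "Y ` libraries N F \<subseteq> {xs. set xs \<subseteq> UNIV \<and> length xs = m}"
    using assms(1) by auto
  then have "card (Y ` libraries N F) \<le> card {xs :: bool list. set xs \<subseteq> UNIV \<and> length xs = m}"
    by (rule card_mono[OF finite_lists_length_eq, rotated]) simp
  also have "\<dots> = 2 ^ m"
    by (subst card_lists_length_eq) auto
  finally have "unif_entropy (libraries N F) Y \<le> log 2 (real (2 ^ m))"
    by (intro unif_entropy_le_card finite_libraries libraries_nonempty)
  then have "unif_entropy (libraries N F) Y \<le> m"
    by (simp add: log_nat_power)
  moreover have "unif_entropy (libraries N F) (observation A B E) \<le> unif_entropy (libraries N F) Y"
    by (intro unif_entropy_mono finite_libraries assms(2))
  ultimately show ?thesis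
    by (simp add: H_def normalized_entropy_eq divide_right_mono)
qed

lemma H_file: "n \<in> {1..N} \<Longrightarrow> H {n} {} {} \<le> 1"
  using H_le_length[of "\<lambda>W. W n" F "{n}" "{}" "{}"] F_pos
  by (auto simp: observation_eq_iff libraries_def PiE_def Pi_def)

lemma H_le_bits:
  assumes "bits_at_most N F (b * real F) Y"
    and "\<And>v w. Y v = Y w \<Longrightarrow> observation A B E v = observation A B E w"
  shows "H A B E \<le> b"
proof -
  obtain m :: nat where m: "real m \<le> b * real F" "\<forall>W \<in> libraries N F. length (Y W) = m"
    using assms(1) unfolding bits_at_most_def by blast
  have "H A B E \<le> real m / real F"
    by (rule H_le_length[OF m(2)[rule_format] assms(2)])
  also have "\<dots> \<le> b"
    using m(1) F_pos by (simp add: field_simps)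
  finally show ?thesis .
qed

lemma H_cache: "k \<in> {1..K} \<Longrightarrow> H {} {k} {} \<le> M"
  using scheme by (intro H_le_bits[of M "Z k"]) (auto simp: caching_scheme_def observation_eq_iff)

lemma H_broadcast: "d \<in> demands N K \<Longrightarrow> H {} {} {d} \<le> R"
  using scheme by (intro H_le_bits[of R "X d"]) (auto simp: caching_scheme_def observation_eq_iff)

lemma H_empty: "H {} {} {} = 0"
proof -
  have "observation {} {} {} = (\<lambda>_. (\<lambda>_. undefined, \<lambda>_. undefined, \<lambda>_. undefined))"
    by (rule ext) (simp add: observation_def restrict_def)
  then show ?thesis
    by (simp add: H_def normalized_entropy_eq unif_entropy_const finite_libraries libraries_nonempty)
qed

text \<open>Subadditivity: file \<open>N\<close> adds at most \<open>1\<close> towards the total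
  \<open>N\<close>.\<close>

lemma H_all_but_last:
  assumes "1 \<le> N"
  shows "real N - 1 \<le> H {1..<N} {} {}"
proof -
  have "{1..<N} \<union> {N} = {1..N}" using assms by auto
  then show ?thesis
    using H_submodular[of "{1..<N}" "{N}" "{}" "{}" "{}" "{}"] H_file[of N] H_all[of "{}" "{}"] assms
    by (simp add: H_empty)
qed

end

section \<open>Consequences of symmetry and the rate inequality\<close>

locale symmetric_caching = caching +
  assumes sym: "symmetric_scheme N K F Z X" and N_ge: "2 \<le> N" and N_le: "N \<le> K"
begin

text \<open>Symmetry for \<open>E = {}\<close>. Reading file \<open>\<sigma> n\<close> for all
  \<open>n\<close> in \<open>A\<close> reveals the same as reading the files with index in the image
  of \<open>A\<close>; likewise for the caches.\<close>

lemma H_permute: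
  assumes "\<pi> permutes {1..K}" "\<sigma> permutes {1..N}" "A \<subseteq> {1..N}" "B \<subseteq> {1..K}"
  shows "H (\<sigma> ` A) (\<pi> ` B) {} = H A B {}"
proof -
  have "H A B {} = normalized_entropy N F
      (\<lambda>W. (\<lambda>n\<in>A. W (\<sigma> n), \<lambda>k\<in>B. Z (\<pi> k) W, \<lambda>d\<in>{}. X (permute_demand K \<sigma> \<pi> d) W))"
    using sym assms unfolding symmetric_scheme_def H_def observation_def by blast
  also have "\<dots> = H (\<sigma> ` A) (\<pi> ` B) {}"
    unfolding H_def normalized_entropy_eq
    by (intro arg_cong2[of _ _ _ _ "(/)"] unif_entropy_cong finite_libraries refl)
      (simp add: observation_eq_iff restrict_eq_iff)
  finally show ?thesis by simp
qed

text \<open>Stands for the entropy of any \<open>a\<close> of the files with any one cache: by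
  symmetry the choice is immaterial.\<close>

definition cache_entropy :: "nat \<Rightarrow> real" where
  "cache_entropy a = H {1..a} {1} {}"

lemma H_files_cache:
  assumes "A \<subseteq> {1..N}" "k \<in> {1..K}"
  shows "H A {k} {} = cache_entropy (card A)"
proof -
  have le: "card A \<le> N"
    using card_mono[OF _ assms(1)] by simp
  obtain \<sigma> where "\<sigma> permutes {1..N}" "\<sigma> ` {1..card A} = A"
    using exists_permutes_image[of "{1..N}" "{1..card A}" A] assms(1) le by auto
  moreover have "Transposition.transpose 1 k permutes {1..K}"
    using assms(2) by (intro permutes_swap_id) auto
  ultimately show ?thesis
    using H_permute[of "Transposition.transpose 1 k" \<sigma> "{1..card A}" "{1}"] assms(2) le
    by (auto simp: cache_entropy_def)
qed

lemma cache_entropy_all: "cache_entropy N = real N"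
  unfolding cache_entropy_def by (rule H_all)

lemma cache_entropy_zero: "cache_entropy 0 \<le> M"
  using H_cache[of 1] N_ge N_le by (simp add: cache_entropy_def)

text \<open>Given the cache, a file adds least when all other files are known. So each of the
  \<open>N\<close> increments of \<open>cache_entropy\<close> is at least the last one, and their
  sum telescopes to \<open>N - cache_entropy 0\<close>.\<close>

lemma cache_entropy_last_ge:
  "(real N - 1) * real N + cache_entropy 0 \<le> real N * cache_entropy (N - 1)"
proof -
  have step: "real N - cache_entropy (N - 1) \<le> cache_entropy (Suc a) - cache_entropy a"
    if a: "a < N" for a
  proof -
    have 1: "1 \<in> {1..K}" using N_ge N_le by simp
    have files: "{1..<N} \<subseteq> {1..N}" by auto
    have un: "{1..<N} \<union> ({1..a} \<union> {N}) = {1..N}" using a by auto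
    have sub: "{1..a} \<subseteq> {1..<N} \<inter> ({1..a} \<union> {N})" using a by auto
    have "H {1..N} {1} {} + H {1..a} {1} {} \<le> H {1..<N} {1} {} + H ({1..a} \<union> {N}) {1} {}"
      by (rule H_submodular_determined) (use sub un in \<open>auto simp: observation_eq_iff\<close>)
    moreover have "card ({1..a} \<union> {N}) = Suc a"
      using a by simp
    ultimately show ?thesis
      using H_files_cache[OF subset_refl 1] H_files_cache[OF files 1] H_files_cache[OF _ 1, of "{1..a}"]
        H_files_cache[OF _ 1, of "{1..a} \<union> {N}"] cache_entropy_all a by auto
  qed
  have "(\<Sum>a<N. real N - cache_entropy (N - 1)) \<le> (\<Sum>a<N. cache_entropy (Suc a) - cache_entropy a)"
    by (intro sum_mono step) simp
  also have "\<dots> = real N - cache_entropy 0"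
    by (simp add: sum_lessThan_telescope cache_entropy_all)
  finally show ?thesis
    by (simp add: algebra_simps)
qed

text \<open>Given \<open>a\<close> files and cache \<open>k\<close>, the broadcast reveals one more file and then still
  carries at least its entropy given all files but \<open>N\<close>.  Averaging over \<open>a\<close> telescopes.\<close>

lemma broadcast_increment_le:
  assumes d: "d \<in> demands N K" and k: "k \<in> {1..K}" and dk: "d k \<in> {1..<N}"
  shows "(real N - 1) * (H {1..<N} {k} {d} - cache_entropy (N - 1)) \<le>
    (real N - 1) * R + cache_entropy 0 - cache_entropy (N - 1)"
proof -
  have step: "H {1..<N} {k} {d} - cache_entropy (N - 1) \<le> R + cache_entropy a - cache_entropy (Suc a)"
    if a: "a < N - 1" for a
  proof -
    \<comment> \<open>\<open>A\<close> must avoid \<open>d k\<close>, the file to be revealed;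
      \<open>a < N - 1\<close> leaves enough other files.\<close>
    have "a \<le> card ({1..<N} - {d k})"
      using a dk by simp
    then obtain A where A: "A \<subseteq> {1..<N} - {d k}" "card A = a" "finite A"
      by (rule obtain_subset_with_card_n)
    have ins: "insert (d k) A \<subseteq> {1..<N}" using A dk by auto
    \<comment> \<open>User \<open>k\<close> decodes file \<open>d k\<close>, which therefore joins
      the left side for free.\<close>
    have "H (insert (d k) A) {k} {d} + H {} {} {} \<le> H A {k} {} + H {} {} {d}"
      by (rule H_submodular_determined) (use decode[OF d k] in \<open>auto simp: observation_eq_iff\<close>)
    \<comment> \<open>Learning the remaining files below \<open>N\<close> can only lower the entropy
      that the broadcast adds.\<close>
    moreover have "H {1..<N} {k} {d} + H (insert (d k) A) {k} {} \<le>
        H (insert (d k) A) {k} {d} + H {1..<N} {k} {}"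
      by (rule H_submodular_determined) (use ins in \<open>auto simp: observation_eq_iff\<close>)
    moreover have "H A {k} {} = cache_entropy a"
      using A by (subst H_files_cache[OF _ k]) auto
    moreover have "H (insert (d k) A) {k} {} = cache_entropy (Suc a)"
    proof -
      have "card (insert (d k) A) = Suc a"
        using A by (subst card_insert_disjoint) auto
      then show ?thesis using ins by (subst H_files_cache[OF _ k]) auto
    qed
    moreover have "H {1..<N} {k} {} = cache_entropy (N - 1)"
      by (subst H_files_cache[OF _ k]) auto
    ultimately show ?thesis
      using H_broadcast[OF d] H_empty by linarith
  qed
  have "(\<Sum>a<N - 1. H {1..<N} {k} {d} - cache_entropy (N - 1)) \<le>
      (\<Sum>a<N - 1. R + (cache_entropy a - cache_entropy (Suc a)))"
    by (rule sum_mono) (use step in \<open>simp add: algebra_simps\<close>)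
  also have "\<dots> = (real N - 1) * R + cache_entropy 0 - cache_entropy (N - 1)"
    using N_ge by (simp add: sum.distrib sum_lessThan_telescope' of_nat_diff)
  finally show ?thesis
    using N_ge by (simp add: of_nat_diff)
qed

text \<open>Given the files below \<open>N\<close> and the earlier broadcasts, the
  \<open>j\<close>-th broadcast adds at least
  \<open>N - cache_entropy (N - 1) - (j - 1) * e\<close>; the penalties add up to
  \<open>K * (K - 1) / 2\<close> times \<open>e\<close>. Together the broadcasts add at most
  \<open>1\<close>, the entropy of file \<open>N\<close>.\<close>

lemma cut_bound:
  assumes inc: "\<And>d k. d \<in> demands N K \<Longrightarrow> k \<in> {1..K} \<Longrightarrow> d k \<in> {1..<N} \<Longrightarrow>
      H {1..<N} {k} {d} - cache_entropy (N - 1) \<le> e"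
  shows "real K * (real N - cache_entropy (N - 1)) - real K * (real K - 1) / 2 * e \<le> 1"
proof -
  obtain D where D: "\<And>j. j \<in> {1..K} \<Longrightarrow> D j \<in> demands N K"
      "\<And>j. j \<in> {1..K} \<Longrightarrow> D j j = N"
      "\<And>j k. j \<in> {1..K} \<Longrightarrow> k \<in> {1..K} \<Longrightarrow> k \<noteq> j \<Longrightarrow> D j k \<in> {1..<N}"
    using exists_demand_only[OF N_ge N_le] by metis
  let ?E = "\<lambda>j. D ` {1..j}"
  \<comment> \<open>As \<open>j < k\<close>, user \<open>k\<close> asks for a file other than
    \<open>N\<close> in each of \<open>D 1\<close> to \<open>D j\<close>, so \<open>inc\<close>
    bounds what each of these broadcasts adds.\<close>
  have cond: "H {1..<N} {k} (?E j) \<le> cache_entropy (N - 1) + real j * e"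
    if k: "k \<in> {1..K}" and "j < k" for j k
    using \<open>j < k\<close>
  proof (induction j)
    case 0
    have "H {1..<N} {k} {} = cache_entropy (N - 1)"
      by (subst H_files_cache[OF _ k]) auto
    then show ?case by simp
  next
    case (Suc j)
    have j: "Suc j \<in> {1..K}" "k \<noteq> Suc j" using Suc.prems k by auto
    have "H {1..<N} {k} (?E (Suc j)) + H {1..<N} {k} {} \<le>
        H {1..<N} {k} (?E j) + H {1..<N} {k} {D (Suc j)}"
      by (rule H_submodular_determined) (auto simp: observation_eq_iff le_Suc_eq)
    moreover have "H {1..<N} {k} {D (Suc j)} - cache_entropy (N - 1) \<le> e"
      using D j k by (intro inc) auto
    moreover have "H {1..<N} {k} {} = cache_entropy (N - 1)"
      by (subst H_files_cache[OF _ k]) auto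
    ultimately show ?case
      using Suc by (simp add: algebra_simps)
  qed
  have "real N - 1 + real j * (real N - cache_entropy (N - 1)) - real j * (real j - 1) / 2 * e
      \<le> H {1..<N} {} (?E j)" if "j \<le> K" for j
    using that
  proof (induction j)
    case 0
    then show ?case using H_all_but_last N_ge by simp
  next
    case (Suc j)
    have j: "Suc j \<in> {1..K}" using Suc.prems by auto
    \<comment> \<open>The broadcast for \<open>D (Suc j)\<close> comes from one summand and cache
      \<open>Suc j\<close> from the other; jointly they decode file \<open>N\<close>, the only one
      missing.\<close>
    have "H {1..N} {} {} + H {1..<N} {} (?E j) \<le>
        H {1..<N} {} (?E (Suc j)) + H {1..<N} {Suc j} (?E j)"
    proof (rule H_submodular_determined)
      fix v w
      assume vw: "v \<in> libraries N F" "w \<in> libraries N F"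
        and P: "observation {1..<N} {} (?E (Suc j)) v = observation {1..<N} {} (?E (Suc j)) w"
        and Q: "observation {1..<N} {Suc j} (?E j) v = observation {1..<N} {Suc j} (?E j) w"
      have "v N = w N"
        using decode[OF D(1)[OF j] j vw] P Q D(2)[OF j] by (simp add: observation_eq_iff)
      moreover have "v n = w n" if "n \<in> {1..<N}" for n
        using P that by (auto simp: observation_eq_iff)
      ultimately show "observation {1..N} {} {} v = observation {1..N} {} {} w"
        by (auto simp: observation_eq_iff le_less)
    qed auto
    then have "real N + H {1..<N} {} (?E j) \<le>
        H {1..<N} {} (?E (Suc j)) + (cache_entropy (N - 1) + real j * e)"
      using cond[OF j, of j] H_all[of "{}" "{}"] by simp
    then show ?case
      using Suc by (simp add: algebra_simps add_divide_distrib diff_divide_distrib)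
  qed
  then have "real N - 1 + real K * (real N - cache_entropy (N - 1)) - real K * (real K - 1) / 2 * e
      \<le> H {1..<N} {} (?E K)"
    by blast
  also have "\<dots> \<le> H {1..N} {} (?E K)"
    by (rule H_mono_determined) (simp add: observation_eq_iff)
  also have "\<dots> = real N"
    by (rule H_all)
  finally show ?thesis by simp
qed

lemma rate_lower_bound:
  assumes "2 * N \<le> K + 1"
  shows "((real K)\<^sup>2 + real K - 2) / (real K * (real K - 1))
           - (real K + 1) / (real N * (real K - 1)) * M \<le> R"
proof -
  define f where "f = cache_entropy (N - 1)"
  define m where "m = cache_entropy 0"
  have n: "real N - 1 > 0" and kp: "real K - 1 > 0" using N_ge N_le by auto
  have kn: "2 * (real N - 1) \<le> real K - 1" using assms by (simp flip: of_nat_le_iff[where 'a = real])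
  \<comment> \<open>The bound of \<open>broadcast_increment_le\<close> divided by
    \<open>N - 1\<close>.\<close>
  define e where "e = R + (m - f) / (real N - 1)"
  have "real K * (real N - f) - real K * (real K - 1) / 2 * e \<le> 1"
    unfolding f_def
  proof (rule cut_bound)
    fix d k assume "d \<in> demands N K" "k \<in> {1..K}" "d k \<in> {1..<N}"
    from broadcast_increment_le[OF this] n
    show "H {1..<N} {k} {d} - cache_entropy (N - 1) \<le> e"
      by (simp add: e_def f_def m_def field_simps)
  qed
  then have cut: "2 * real K * (real N - f) \<le> real K * (real K - 1) * e + 2"
    by simp
  \<comment> \<open>\<open>\<mu>\<close> is the cache entropy per file, and \<open>t\<close> is the
    excess of \<open>f\<close> over its lower bound \<open>N - 1 + \<mu>\<close> in units of
    \<open>N - 1\<close>. This choice makes \<open>e\<close> equal to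
    \<open>R + \<mu> - 1 - t\<close>.\<close>
  define \<mu> where "\<mu> = m / real N"
  define t where "t = (f - (real N - 1) - \<mu>) / (real N - 1)"
  have m: "m = real N * \<mu>" using N_ge by (simp add: \<mu>_def)
  have f: "f = real N - 1 + \<mu> + (real N - 1) * t"
    using n by (simp add: t_def)
  have "real N * (real N - 1 + \<mu>) \<le> real N * f"
    using cache_entropy_last_ge[folded f_def m_def] m by (simp add: algebra_simps)
  then have "real N - 1 + \<mu> \<le> f"
    using N_ge by simp
  then have t: "t \<ge> 0"
    using n by (simp add: t_def)
  have "m - f = (real N - 1) * (\<mu> - 1 - t)"
    unfolding m f by (simp add: algebra_simps)
  then have e: "e = R + (\<mu> - 1 - t)"
    using n by (simp add: e_def)
  have "real K * t * (2 * (real N - 1)) \<le> real K * t * (real K - 1)"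
    using kn t by (intro mult_left_mono) auto
  then have "(real K)\<^sup>2 + real K - 2 - real K * (real K + 1) * \<mu> \<le> real K * (real K - 1) * R"
    using cut unfolding e f by (simp add: algebra_simps power2_eq_square)
  then have "(real K)\<^sup>2 + real K - 2 - real K * (real K + 1) * (m / real N) \<le> real K * (real K - 1) * R"
    by (simp add: \<mu>_def)
  \<comment> \<open>The cache entropy enters with a negative sign, so it may be replaced by
    \<open>M\<close>.\<close>
  moreover have "real K * (real K + 1) * (m / real N) \<le> real K * (real K + 1) * (M / real N)"
    using cache_entropy_zero by (intro mult_left_mono divide_right_mono) (auto simp: m_def)
  ultimately have "(real K)\<^sup>2 + real K - 2 - real K * (real K + 1) * (M / real N) \<le> real K * (real K - 1) * R"
    by linarith
  moreover have "real K * (real K - 1) > 0" using kp by simp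
  ultimately have "((real K)\<^sup>2 + real K - 2 - real K * (real K + 1) * (M / real N)) / (real K * (real K - 1)) \<le> R"
    by (simp add: pos_divide_le_eq mult.commute)
  moreover have "((real K)\<^sup>2 + real K - 2 - real K * (real K + 1) * (M / real N)) / (real K * (real K - 1)) =
     ((real K)\<^sup>2 + real K - 2) / (real K * (real K - 1)) - (real K + 1) / (real N * (real K - 1)) * M"
    using kp N_ge by (simp add: diff_divide_distrib)
  ultimately show ?thesis by simp
qed

end

section \<open>Achievability by coded multicasting\<close>

text \<open>A fixed order of a finite index set, by which a family of bits becomes a bit string;
  \<open>lookup\<close> reads the string back by index.\<close>

definition enum :: "'a set \<Rightarrow> 'a list" where
  "enum A = (SOME xs. set xs = A \<and> distinct xs)"

lemma enum:
  assumes "finite A"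
  shows "set (enum A) = A" "distinct (enum A)" "length (enum A) = card A"
proof -
  have "set (enum A) = A \<and> distinct (enum A)"
    unfolding enum_def using finite_distinct_list[OF assms] by (rule someI_ex)
  then show "set (enum A) = A" "distinct (enum A)" "length (enum A) = card A"
    using distinct_card by fastforce+
qed

definition lookup :: "'a list \<Rightarrow> 'b list \<Rightarrow> 'a \<Rightarrow> 'b" where
  "lookup xs bs x = the (map_of (zip xs bs) x)"

lemma lookup_map: "x \<in> set xs \<Longrightarrow> lookup xs (map f xs) x = f x"
  by (simp add: lookup_def map_of_zip_map)

lemma map_lookup:
  assumes "distinct xs" "length bs = length xs"
  shows "map (lookup xs bs) xs = bs"
  using assms by (intro nth_equalityI) (auto simp: lookup_def map_of_zip_nth)

text \<open>Label \<open>(P, j)\<close> names a bit of a file that is missing exactly from the caches of the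
  users in \<open>P\<close>; the weight \<open>c p\<close> is the number of bits for each \<open>P\<close> with \<open>p\<close> elements.
  Weights supported on two sizes amount to memory sharing.\<close>

definition labels :: "nat set \<Rightarrow> (nat \<Rightarrow> nat) \<Rightarrow> (nat set \<times> nat) set" where
  "labels S c = (SIGMA P : Pow S. {..<c (card P)})"

lemma in_labels_iff: "(P, j) \<in> labels S c \<longleftrightarrow> P \<subseteq> S \<and> j < c (card P)"
  by (simp add: labels_def)

lemma finite_labels: "finite S \<Longrightarrow> finite (labels S c)"
  by (simp add: labels_def)

lemma card_labels:
  assumes "finite S"
  shows "card (labels S c) = (\<Sum>p\<le>card S. (card S choose p) * c p)"
proof -
  have "card (labels S c) = (\<Sum>P\<in>Pow S. c (card P))"
    using assms by (simp add: labels_def)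
  also have "\<dots> = (\<Sum>p\<le>card S. \<Sum>P\<in>{P\<in>Pow S. card P = p}. c (card P))"
    using assms by (intro sum.group[symmetric]) (auto intro: card_mono)
  also have "\<dots> = (\<Sum>p\<le>card S. (card S choose p) * c p)"
  proof (rule sum.cong[OF refl])
    fix p
    have "(\<Sum>P\<in>{P\<in>Pow S. card P = p}. c (card P)) = (\<Sum>P\<in>{P. P \<subseteq> S \<and> card P = p}. c p)"
      by (rule sum.cong) auto
    then show "(\<Sum>P\<in>{P\<in>Pow S. card P = p}. c (card P)) = (card S choose p) * c p"
      using n_subsets[OF assms] by simp
  qed
  finally show ?thesis .
qed

text \<open>Transports statements about labels along a renaming of users; the weight depends on
  \<open>card P\<close> alone, which an injection preserves.\<close>

lemma ball_labels_image:
  assumes \<pi>: "inj \<pi>"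
  shows "(\<forall>P j. (P, j) \<in> labels (\<pi> ` S) c \<longrightarrow> f P j) \<longleftrightarrow> (\<forall>P j. (P, j) \<in> labels S c \<longrightarrow> f (\<pi> ` P) j)"
proof -
  have card: "card (\<pi> ` P) = card P" for P
    by (rule card_image[OF inj_on_subset[OF \<pi> subset_UNIV]])
  show ?thesis
  proof (intro iffI allI impI)
    fix P j
    assume "\<forall>P j. (P, j) \<in> labels (\<pi> ` S) c \<longrightarrow> f P j" "(P, j) \<in> labels S c"
    then show "f (\<pi> ` P) j"
      by (simp add: in_labels_iff card image_mono)
  next
    fix P j
    assume f: "\<forall>P j. (P, j) \<in> labels S c \<longrightarrow> f (\<pi> ` P) j" and P: "(P, j) \<in> labels (\<pi> ` S) c"
    then obtain P' where "P' \<subseteq> S" "P = \<pi> ` P'"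
      by (auto simp: in_labels_iff subset_image_iff)
    then show "f P j"
      using f P by (simp add: in_labels_iff card)
  qed
qed

text \<open>Parity is the exclusive or of the membership bits, so together with all bits but that of
  \<open>k\<close> it determines the bit of \<open>k\<close>.\<close>

lemma odd_card_eq_imp_mem_iff:
  assumes "finite A" "finite B" "A - {k} = B - {k}" "odd (card A) \<longleftrightarrow> odd (card B)"
  shows "k \<in> A \<longleftrightarrow> k \<in> B"
proof -
  have "odd (card C) \<longleftrightarrow> (k \<in> C \<longleftrightarrow> even (card (C - {k})))" if "finite C" for C
  proof (cases "k \<in> C")
    case True
    then have "odd (card C) \<longleftrightarrow> even (card (C - {k}))"
      by (metis card_Suc_Diff1[OF that] even_Suc)
    with True show ?thesis by blast
  qed simp
  then show ?thesis
    using assms by metis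
qed

section \<open>The coded multicast scheme for arbitrary weights and its symmetry\<close>

locale multicast =
  fixes N K :: nat and c :: "nat \<Rightarrow> nat"
begin

definition I :: "(nat set \<times> nat) set" where "I = labels {1..K} c"

definition F :: nat where "F = card I"

definition piece :: "files \<Rightarrow> nat \<Rightarrow> nat set \<Rightarrow> nat \<Rightarrow> bool" where
  "piece W n P j = lookup (enum I) (W n) (P, j)"

definition cache :: "nat \<Rightarrow> files \<Rightarrow> bool list" where
  "cache k W = map (\<lambda>(n, P, j). piece W n P j) (enum ({1..N} \<times> labels ({1..K} - {k}) c))"

text \<open>The exclusive or meant for the users outside \<open>Q\<close>: the piece for user
  \<open>k\<close> is missing exactly from the caches of \<open>k\<close> and of the users in
  \<open>Q\<close>, so every other user outside \<open>Q\<close> holds it.\<close>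

definition coded_bit :: "demand \<Rightarrow> files \<Rightarrow> nat set \<Rightarrow> nat \<Rightarrow> bool" where
  "coded_bit d W Q j = odd (card {k \<in> {1..K} - Q. piece W (d k) (insert k Q) j})"

text \<open>The weight is shifted by \<open>Suc\<close> because the pieces combined for
  \<open>Q\<close> have labels of size \<open>card Q + 1\<close>.\<close>

definition broadcast :: "demand \<Rightarrow> files \<Rightarrow> bool list" where
  "broadcast d W = map (\<lambda>(Q, j). coded_bit d W Q j) (enum (labels {1..K} (c \<circ> Suc)))"

lemma in_I_iff: "(P, j) \<in> I \<longleftrightarrow> P \<subseteq> {1..K} \<and> j < c (card P)"
  by (simp add: I_def in_labels_iff)

lemma enum_I: "set (enum I) = I" "distinct (enum I)" "length (enum I) = F"
  using enum[OF finite_labels[OF finite_atLeastAtMost]] by (simp_all add: F_def I_def)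

lemma file_eq_iff:
  assumes "v \<in> libraries N F" "w \<in> libraries N F" "n \<in> {1..N}"
  shows "v n = w n \<longleftrightarrow> (\<forall>P j. (P, j) \<in> I \<longrightarrow> piece v n P j = piece w n P j)"
proof
  have len: "length (v n) = F" "length (w n) = F"
    using assms by (auto simp: libraries_def PiE_def Pi_def)
  assume eq: "\<forall>P j. (P, j) \<in> I \<longrightarrow> piece v n P j = piece w n P j"
  have "map (lookup (enum I) (v n)) (enum I) = map (lookup (enum I) (w n)) (enum I)"
    using eq by (intro map_cong refl) (auto simp: piece_def enum_I)
  then show "v n = w n"
    using map_lookup[OF enum_I(2)] len enum_I(3) by metis
qed (simp add: piece_def)

lemma cache_eq_iff:
  "cache k v = cache k w \<longleftrightarrow>
     (\<forall>n\<in>{1..N}. \<forall>P j. (P, j) \<in> labels ({1..K} - {k}) c \<longrightarrow> piece v n P j = piece w n P j)"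
proof -
  have "set (enum ({1..N} \<times> labels ({1..K} - {k}) c)) = {1..N} \<times> labels ({1..K} - {k}) c"
    by (simp add: enum finite_labels)
  then show ?thesis
    unfolding cache_def map_eq_conv by auto
qed

lemma broadcast_eq_iff:
  "broadcast d v = broadcast d w \<longleftrightarrow>
     (\<forall>Q j. (Q, j) \<in> labels {1..K} (c \<circ> Suc) \<longrightarrow> coded_bit d v Q j = coded_bit d w Q j)"
proof -
  have "set (enum (labels {1..K} (c \<circ> Suc))) = labels {1..K} (c \<circ> Suc)"
    by (simp add: enum finite_labels)
  then show ?thesis
    unfolding broadcast_def map_eq_conv by auto
qed

lemma length_cache: "length (cache k W) = N * card (labels ({1..K} - {k}) c)"
  by (simp add: cache_def enum finite_labels card_cartesian_product)

lemma length_broadcast: "length (broadcast d W) = card (labels {1..K} (c \<circ> Suc))"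
  by (simp add: broadcast_def enum finite_labels)

lemma insert_label:
  assumes "(Q, j) \<in> labels {1..K} (c \<circ> Suc)" "k \<in> {1..K} - Q"
  shows "(insert k Q, j) \<in> I"
proof -
  have "finite Q" using assms(1) finite_subset by (auto simp: in_I_iff in_labels_iff)
  then show ?thesis
    using assms by (auto simp: in_I_iff in_labels_iff)
qed

text \<open>Pieces whose label omits \<open>k\<close> are cached. If \<open>k\<close> is in
  \<open>P\<close>, the broadcast bit for \<open>P - {k}\<close> combines the wanted piece with
  pieces that user \<open>k\<close> has cached, and parity yields the wanted one.\<close>

lemma decodable:
  assumes vw: "v \<in> libraries N F" "w \<in> libraries N F" and d: "d \<in> demands N K" and k: "k \<in> {1..K}"
    and Z: "cache k v = cache k w" and X: "broadcast d v = broadcast d w"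
  shows "v (d k) = w (d k)"
proof -
  have range: "d i \<in> {1..N}" if "i \<in> {1..K}" for i
    using d that by (auto simp: demands_def)
  have cached: "piece v (d i) P j = piece w (d i) P j"
    if "i \<in> {1..K}" "(P, j) \<in> I" "k \<notin> P" for i P j
    using Z range[OF that(1)] that(2,3) unfolding cache_eq_iff by (simp add: in_labels_iff in_I_iff subset_Diff_insert)
  have "piece v (d k) P j = piece w (d k) P j" if P: "(P, j) \<in> I" for P j
  proof (cases "k \<in> P")
    case True
    define Q where "Q = P - {k}"
    have "finite P" using P finite_subset by (auto simp: in_I_iff in_labels_iff)
    then have "card P = Suc (card Q)"
      using card_Suc_Diff1[of P k] True by (simp add: Q_def)
    then have Q: "(Q, j) \<in> labels {1..K} (c \<circ> Suc)"
      using P by (auto simp: in_I_iff in_labels_iff Q_def)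
    define S where "S W = {i \<in> {1..K} - Q. piece W (d i) (insert i Q) j}" for W
    have "piece v (d i) (insert i Q) j = piece w (d i) (insert i Q) j" if "i \<in> {1..K} - Q" "i \<noteq> k" for i
      using that insert_label[OF Q] by (intro cached) (auto simp: Q_def)
    then have "S v - {k} = S w - {k}"
      by (auto simp: S_def)
    moreover have "odd (card (S v)) \<longleftrightarrow> odd (card (S w))"
      using X Q unfolding broadcast_eq_iff coded_bit_def S_def by blast
    ultimately have "k \<in> S v \<longleftrightarrow> k \<in> S w"
      by (intro odd_card_eq_imp_mem_iff) (simp_all add: S_def)
    moreover have "insert k Q = P" "k \<in> {1..K} - Q"
      using True k by (auto simp: Q_def)
    ultimately show ?thesis
      by (simp add: S_def)
  qed (rule cached[OF k P])
  then show ?thesis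
    using file_eq_iff[OF vw range[OF k]] by blast
qed

text \<open>Carries out the renaming of files by \<open>\<sigma>\<close> and of users by
  \<open>\<pi>\<close> inside the library, so that permuting a scheme amounts to a bijection of
  libraries.\<close>

definition relabel :: "(nat \<Rightarrow> nat) \<Rightarrow> (nat \<Rightarrow> nat) \<Rightarrow> files \<Rightarrow> files" where
  "relabel \<sigma> \<pi> W = (\<lambda>n\<in>{1..N}. map (\<lambda>(P, j). piece W (\<sigma> n) (\<pi> ` P) j) (enum I))"

lemma piece_relabel:
  "n \<in> {1..N} \<Longrightarrow> (P, j) \<in> I \<Longrightarrow> piece (relabel \<sigma> \<pi> W) n P j = piece W (\<sigma> n) (\<pi> ` P) j"
  using lookup_map[of "(P, j)" "enum I" "\<lambda>(P, j). piece W (\<sigma> n) (\<pi> ` P) j"]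
  by (simp add: piece_def relabel_def enum_I)

lemma relabel_in_libraries: "relabel \<sigma> \<pi> W \<in> libraries N F"
  unfolding relabel_def libraries_def by (rule restrict_PiE[THEN iffD2]) (simp add: enum_I)

context
  fixes \<sigma> \<pi> :: "nat \<Rightarrow> nat"
  assumes \<sigma>: "\<sigma> permutes {1..N}" and \<pi>: "\<pi> permutes {1..K}"
begin

lemma file_relabel_eq_iff:
  assumes vw: "v \<in> libraries N F" "w \<in> libraries N F" and n: "n \<in> {1..N}"
  shows "relabel \<sigma> \<pi> v n = relabel \<sigma> \<pi> w n \<longleftrightarrow> v (\<sigma> n) = w (\<sigma> n)"
proof -
  have "relabel \<sigma> \<pi> v n = relabel \<sigma> \<pi> w n \<longleftrightarrow>
      (\<forall>P j. (P, j) \<in> I \<longrightarrow> piece v (\<sigma> n) (\<pi> ` P) j = piece w (\<sigma> n) (\<pi> ` P) j)"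
    unfolding file_eq_iff[OF relabel_in_libraries relabel_in_libraries n]
    using n by (auto simp: piece_relabel)
  also have "\<dots> \<longleftrightarrow> (\<forall>P j. (P, j) \<in> I \<longrightarrow> piece v (\<sigma> n) P j = piece w (\<sigma> n) P j)"
    unfolding I_def ball_labels_image[OF permutes_inj[OF \<pi>], of "{1..K}" c
        "\<lambda>P j. piece v (\<sigma> n) P j = piece w (\<sigma> n) P j", symmetric] permutes_image[OF \<pi>] ..
  also have "\<dots> \<longleftrightarrow> v (\<sigma> n) = w (\<sigma> n)"
    using file_eq_iff[OF vw, of "\<sigma> n"] permutes_in_image[OF \<sigma>] n by blast
  finally show ?thesis .
qed

lemma cache_relabel_eq_iff:
  "cache k (relabel \<sigma> \<pi> v) = cache k (relabel \<sigma> \<pi> w) \<longleftrightarrow> cache (\<pi> k) v = cache (\<pi> k) w"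
proof -
  have sub: "labels ({1..K} - {k}) c \<subseteq> I"
    by (auto simp: labels_def I_def)
  have image: "\<pi> ` ({1..K} - {k}) = {1..K} - {\<pi> k}"
    using permutes_inj[OF \<pi>] permutes_image[OF \<pi>] by (simp add: image_set_diff)
  have "cache k (relabel \<sigma> \<pi> v) = cache k (relabel \<sigma> \<pi> w) \<longleftrightarrow>
      (\<forall>n\<in>{1..N}. \<forall>P j. (P, j) \<in> labels ({1..K} - {k}) c \<longrightarrow>
         piece v (\<sigma> n) (\<pi> ` P) j = piece w (\<sigma> n) (\<pi> ` P) j)"
    unfolding cache_eq_iff using sub by (auto simp: piece_relabel subset_iff)
  also have "\<dots> \<longleftrightarrow> (\<forall>n\<in>{1..N}. \<forall>P j. (P, j) \<in> labels ({1..K} - {\<pi> k}) c \<longrightarrow>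
         piece v (\<sigma> n) P j = piece w (\<sigma> n) P j)"
    unfolding ball_labels_image[OF permutes_inj[OF \<pi>], of "{1..K} - {k}" c
        "\<lambda>P j. piece v (\<sigma> n) P j = piece w (\<sigma> n) P j" for n, symmetric] image ..
  also have "\<dots> \<longleftrightarrow> (\<forall>n\<in>\<sigma> ` {1..N}. \<forall>P j. (P, j) \<in> labels ({1..K} - {\<pi> k}) c \<longrightarrow>
         piece v n P j = piece w n P j)"
    by simp
  also have "\<dots> \<longleftrightarrow> cache (\<pi> k) v = cache (\<pi> k) w"
    unfolding cache_eq_iff permutes_image[OF \<sigma>] ..
  finally show ?thesis .
qed

lemma coded_bit_relabel:
  assumes d: "d \<in> demands N K" and Q: "(Q, j) \<in> labels {1..K} (c \<circ> Suc)"
  shows "coded_bit d (relabel \<sigma> \<pi> W) Q j = coded_bit (permute_demand K \<sigma> \<pi> d) W (\<pi> ` Q) j"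
proof -
  have range: "d i \<in> {1..N}" if "i \<in> {1..K}" for i
    using d that by (auto simp: demands_def)
  let ?A = "{k \<in> {1..K} - Q. piece W (\<sigma> (d k)) (\<pi> ` insert k Q) j}"
  let ?B = "{k \<in> {1..K} - \<pi> ` Q. piece W (permute_demand K \<sigma> \<pi> d k) (insert k (\<pi> ` Q)) j}"
  have "{k \<in> {1..K} - Q. piece (relabel \<sigma> \<pi> W) (d k) (insert k Q) j} = ?A"
    using range insert_label[OF Q] by (auto simp: piece_relabel)
  \<comment> \<open>The summand of user \<open>k\<close> becomes that of user
    \<open>\<pi> k\<close>, whose permuted demand is \<open>\<sigma> (d k)\<close>.\<close>
  moreover have "\<pi> ` ?A = ?B"
  proof (intro equalityI subsetI)
    fix i assume "i \<in> \<pi> ` ?A"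
    then show "i \<in> ?B"
      using permutes_in_image[OF \<pi>] permutes_inj[OF \<pi>]
      by (auto simp: permute_demand_def permutes_inverses[OF \<pi>] dest: injD)
  next
    fix i assume i: "i \<in> ?B"
    have "inv \<pi> i \<in> {1..K}"
      using i permutes_in_image[OF permutes_inv[OF \<pi>]] by auto
    moreover have "inv \<pi> i \<notin> Q"
      using i permutes_inverses(1)[OF \<pi>, of i] by (metis (no_types, lifting) DiffE imageI mem_Collect_eq)
    ultimately have "inv \<pi> i \<in> ?A"
      using i by (auto simp: permute_demand_def permutes_inverses[OF \<pi>])
    then show "i \<in> \<pi> ` ?A"
      using permutes_inverses(1)[OF \<pi>, of i] by (metis (no_types, lifting) imageI)
  qed
  then have "card ?B = card ?A"
    using card_image[OF inj_on_subset[OF permutes_inj[OF \<pi>]], of ?A] by simp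
  ultimately show ?thesis
    by (simp add: coded_bit_def)
qed

lemma broadcast_relabel_eq_iff:
  assumes d: "d \<in> demands N K"
  shows "broadcast d (relabel \<sigma> \<pi> v) = broadcast d (relabel \<sigma> \<pi> w) \<longleftrightarrow>
    broadcast (permute_demand K \<sigma> \<pi> d) v = broadcast (permute_demand K \<sigma> \<pi> d) w"
proof -
  let ?d = "permute_demand K \<sigma> \<pi> d"
  have "broadcast d (relabel \<sigma> \<pi> v) = broadcast d (relabel \<sigma> \<pi> w) \<longleftrightarrow>
      (\<forall>Q j. (Q, j) \<in> labels {1..K} (c \<circ> Suc) \<longrightarrow> coded_bit ?d v (\<pi> ` Q) j = coded_bit ?d w (\<pi> ` Q) j)"
    unfolding broadcast_eq_iff by (auto simp: coded_bit_relabel[OF d])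
  also have "\<dots> \<longleftrightarrow> broadcast ?d v = broadcast ?d w"
    unfolding broadcast_eq_iff
      ball_labels_image[OF permutes_inj[OF \<pi>], of "{1..K}" "c \<circ> Suc"
        "\<lambda>Q j. coded_bit ?d v Q j = coded_bit ?d w Q j", symmetric] permutes_image[OF \<pi>] ..
  finally show ?thesis .
qed

lemma bij_relabel: "bij_betw (relabel \<sigma> \<pi>) (libraries N F) (libraries N F)"
proof -
  have inj: "inj_on (relabel \<sigma> \<pi>) (libraries N F)"
  proof (rule inj_onI)
    fix v w assume vw: "v \<in> libraries N F" "w \<in> libraries N F" and eq: "relabel \<sigma> \<pi> v = relabel \<sigma> \<pi> w"
    show "v = w"
    proof (rule libraries_eqI[OF vw])
      fix n assume "n \<in> {1..N}"
      then obtain i where "i \<in> {1..N}" "n = \<sigma> i"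
        using permutes_image[OF \<sigma>] by blast
      then show "v n = w n"
        using file_relabel_eq_iff[OF vw] eq by simp
    qed
  qed
  moreover have "relabel \<sigma> \<pi> ` libraries N F = libraries N F"
    by (rule endo_inj_surj[OF finite_libraries _ inj]) (auto simp: relabel_in_libraries)
  ultimately show ?thesis
    by (simp add: bij_betw_def)
qed

end

text \<open>\<open>relabel\<close> is a bijection of the library space, and observing a relabelled
  library reveals the same as making the permuted observation on the original one.\<close>

lemma symmetric: "symmetric_scheme N K F cache broadcast"
  unfolding symmetric_scheme_def
proof (intro allI impI)
  fix \<pi> \<sigma> A B E
  assume \<pi>: "\<pi> permutes {1..K}" and \<sigma>: "\<sigma> permutes {1..N}"
    and sub: "A \<subseteq> {1..N}" "B \<subseteq> {1..K}" "E \<subseteq> demands N K"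
  show "normalized_entropy N F (\<lambda>W. (\<lambda>n\<in>A. W n, \<lambda>k\<in>B. cache k W, \<lambda>d\<in>E. broadcast d W)) =
    normalized_entropy N F (\<lambda>W. (\<lambda>n\<in>A. W (\<sigma> n), \<lambda>k\<in>B. cache (\<pi> k) W,
      \<lambda>d\<in>E. broadcast (permute_demand K \<sigma> \<pi> d) W))"
    unfolding normalized_entropy_eq
  proof (intro arg_cong2[of _ _ _ _ "(/)"] refl unif_entropy_bij[OF finite_libraries bij_relabel[OF \<sigma> \<pi>]])
    fix v w assume "v \<in> libraries N F" "w \<in> libraries N F"
    then have "(\<forall>n\<in>A. relabel \<sigma> \<pi> v n = relabel \<sigma> \<pi> w n) \<longleftrightarrow> (\<forall>n\<in>A. v (\<sigma> n) = w (\<sigma> n))"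
      using file_relabel_eq_iff[OF \<sigma> \<pi>] sub(1) by (intro ball_cong refl) auto
    moreover have "(\<forall>d\<in>E. broadcast d (relabel \<sigma> \<pi> v) = broadcast d (relabel \<sigma> \<pi> w)) \<longleftrightarrow>
      (\<forall>d\<in>E. broadcast (permute_demand K \<sigma> \<pi> d) v = broadcast (permute_demand K \<sigma> \<pi> d) w)"
      using broadcast_relabel_eq_iff[OF \<sigma> \<pi>] sub(3) by (intro ball_cong refl) auto
    ultimately show "((\<lambda>n\<in>A. relabel \<sigma> \<pi> v n, \<lambda>k\<in>B. cache k (relabel \<sigma> \<pi> v),
          \<lambda>d\<in>E. broadcast d (relabel \<sigma> \<pi> v)) =
        (\<lambda>n\<in>A. relabel \<sigma> \<pi> w n, \<lambda>k\<in>B. cache k (relabel \<sigma> \<pi> w),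
          \<lambda>d\<in>E. broadcast d (relabel \<sigma> \<pi> w))) \<longleftrightarrow>
      ((\<lambda>n\<in>A. v (\<sigma> n), \<lambda>k\<in>B. cache (\<pi> k) v, \<lambda>d\<in>E. broadcast (permute_demand K \<sigma> \<pi> d) v) =
        (\<lambda>n\<in>A. w (\<sigma> n), \<lambda>k\<in>B. cache (\<pi> k) w, \<lambda>d\<in>E. broadcast (permute_demand K \<sigma> \<pi> d) w))"
      by (simp add: restrict_eq_iff cache_relabel_eq_iff[OF \<sigma> \<pi>])
  qed
qed

lemma achievable:
  assumes "0 < F" "0 \<le> M" "M \<le> real N" "0 \<le> R"
    and Z: "\<And>k. k \<in> {1..K} \<Longrightarrow> real (N * card (labels ({1..K} - {k}) c)) \<le> M * real F"
    and X: "real (card (labels {1..K} (c \<circ> Suc))) \<le> R * real F"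
  shows "achievable N K M R"
proof -
  have "\<exists>\<psi>. \<forall>W \<in> libraries N F. \<psi> (cache k W) (broadcast d W) = W (d k)"
    if "d \<in> demands N K" "k \<in> {1..K}" for d k
  proof (intro exI ballI)
    \<comment> \<open>The decoder returns file \<open>d k\<close> of any library consistent with
      cache and broadcast; by \<open>decodable\<close> the choice does not matter.\<close>
    let ?\<psi> = "\<lambda>z x. (SOME W. W \<in> libraries N F \<and> cache k W = z \<and> broadcast d W = x) (d k)"
    fix W assume W: "W \<in> libraries N F"
    let ?V = "SOME V. V \<in> libraries N F \<and> cache k V = cache k W \<and> broadcast d V = broadcast d W"
    have "?V \<in> libraries N F \<and> cache k ?V = cache k W \<and> broadcast d ?V = broadcast d W"
      by (rule someI[of _ W]) (simp add: W)
    then show "?\<psi> (cache k W) (broadcast d W) = W (d k)"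
      using decodable[OF _ W that] by blast
  qed
  moreover have "bits_at_most N F (M * real F) (cache k)" if "k \<in> {1..K}" for k
    unfolding bits_at_most_def using Z[OF that] length_cache by (intro exI conjI ballI)
  moreover have "bits_at_most N F (R * real F) (broadcast d)" for d
    unfolding bits_at_most_def using X length_broadcast by (intro exI conjI ballI)
  ultimately have "caching_scheme N K M R F cache broadcast"
    unfolding caching_scheme_def using assms(1) by simp
  then show ?thesis
    unfolding achievable_def using assms(2-4) symmetric by (intro conjI exI)
qed

end

section \<open>Memory sharing and the exact rate\<close>

lemma sum_choose_two_weights:
  "(\<Sum>p\<le>n. (n choose p) * (if p = 1 then b else if p = 2 then a else 0)) = n * b + (n choose 2) * a"
proof -
  have "(\<Sum>p\<le>n. (n choose p) * (if p = 1 then b else if p = 2 then a else 0)) =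
      (\<Sum>p\<le>n. (if p = 1 then n * b else 0) + (if p = 2 then (n choose 2) * a else 0))"
    by (rule sum.cong) auto
  also have "\<dots> = n * b + (n choose 2) * a"
    unfolding sum.distrib by (subst (1 2) sum.delta) (auto simp: not_le less_Suc_eq numeral_2_eq_2)
  finally show ?thesis .
qed

lemma sum_choose_two_weights_Suc:
  "(\<Sum>p\<le>n. (n choose p) * (if Suc p = 1 then b else if Suc p = 2 then a else 0)) = b + n * a"
proof -
  have "(\<Sum>p\<le>n. (n choose p) * (if Suc p = 1 then b else if Suc p = 2 then a else 0)) =
      (\<Sum>p\<le>n. (if p = 0 then b else 0) + (if p = 1 then n * a else 0))"
    by (rule sum.cong) auto
  also have "\<dots> = b + n * a"
    unfolding sum.distrib by (subst (1 2) sum.delta) (auto simp: not_le)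
  finally show ?thesis .
qed

lemma choose_two_times_double: "(n choose 2) * (2 * p) = n * (n - 1) * p"
proof -
  have "(n choose 2) * 2 = n * (n - 1)"
    unfolding choose_two by (rule dvd_div_mult_self) (cases n; simp)
  then show ?thesis
    by (simp only: mult.assoc[symmetric])
qed

definition memory_sharing_rate :: "nat \<Rightarrow> nat \<Rightarrow> real \<Rightarrow> real" where
  "memory_sharing_rate N K M = ((real K)\<^sup>2 + real K - 2) / (real K * (real K - 1))
     - (real K + 1) / (real N * (real K - 1)) * M"

text \<open>Bits are shared in proportion \<open>p\<close> to \<open>r\<close> between pieces
  missing from two caches, alone giving \<open>M' = N * (K - 2) / K\<close>, and from one, alone
  giving \<open>M' = N * (K - 1) / K\<close>. Allowing \<open>M\<close> above \<open>M'\<close>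
  serves irrational cache sizes.\<close>

lemma memory_sharing_achievable:
  fixes p r :: nat
  assumes N: "1 \<le> N" and K: "3 \<le> K" and q: "0 < p + r"
    and M': "M' = real N * ((real K - 1) * real (p + r) - real p) / (real K * real (p + r))"
    and M: "M' \<le> M" "M \<le> real N"
  shows "achievable N K M (memory_sharing_rate N K M')"
proof -
  \<comment> \<open>Labels of size one then carry \<open>K * (K - 1) * r\<close> bits of a file and
    labels of size two \<open>K * (K - 1) * p\<close>.\<close>
  define c where "c n = (if n = 1 then r * (K - 1) else if n = 2 then 2 * p else 0)" for n :: nat
  interpret multicast N K c .
  obtain k where k: "K = Suc (Suc k)" using that[of "K - 2"] K by simp
  have kpos: "real k > 0" using K k by simp
  let ?q = "real (p + r)"
  have q0: "?q > 0" using q by linarith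
  have "F = K * (r * (K - 1)) + (K choose 2) * (2 * p)"
    using sum_choose_two_weights[of K "r * (K - 1)" "2 * p"]
    by (simp add: F_def I_def card_labels c_def)
  also have "\<dots> = K * (K - 1) * (p + r)"
    unfolding choose_two_times_double by (simp add: algebra_simps)
  finally have F: "real F = real K * (real K - 1) * ?q"
    by (simp add: k algebra_simps)
  then have F0: "real F > 0"
    using K q0 by simp
  have M'F: "M' * real F = real N * (real K - 1) * ((real K - 1) * ?q - real p)"
    unfolding M' F using K q0 by simp
  have cached: "real (N * card (labels ({1..K} - {u}) c)) = M' * real F" if "u \<in> {1..K}" for u
  proof -
    have "card ({1..K} - {u}) = K - 1" using that by simp
    then have "card (labels ({1..K} - {u}) c) = (K - 1) * (r * (K - 1)) + ((K - 1) choose 2) * (2 * p)"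
      using sum_choose_two_weights[of "K - 1" "r * (K - 1)" "2 * p"]
      by (simp add: card_labels c_def)
    also have "\<dots> = (K - 1) * (r * (K - 1) + (K - 2) * p)"
      unfolding choose_two_times_double by (simp add: k algebra_simps)
    finally show ?thesis
      unfolding M'F by (simp add: k algebra_simps)
  qed
  have "card (labels {1..K} (c \<circ> Suc)) = r * (K - 1) + K * (2 * p)"
    using sum_choose_two_weights_Suc[of K "r * (K - 1)" "2 * p"]
    by (simp add: card_labels c_def)
  then have sent: "real (card (labels {1..K} (c \<circ> Suc))) = real r * (real K - 1) + real K * (2 * real p)"
    by (simp add: k algebra_simps)
  have "memory_sharing_rate N K M' * real F =
      ((real K)\<^sup>2 + real K - 2) / (real K * (real K - 1)) * real F
      - (real K + 1) / (real N * (real K - 1)) * (M' * real F)"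
    by (simp add: memory_sharing_rate_def algebra_simps)
  also have "\<dots> = ((real K)\<^sup>2 + real K - 2) * ?q - (real K + 1) * ((real K - 1) * ?q - real p)"
    unfolding M'F unfolding F using K N by simp
  also have "\<dots> = real (card (labels {1..K} (c \<circ> Suc)))"
    unfolding sent by (simp add: algebra_simps power2_eq_square)
  finally have rate: "memory_sharing_rate N K M' * real F = real (card (labels {1..K} (c \<circ> Suc)))" .
  show ?thesis
  proof (rule achievable)
    show "0 < F" using F0 by simp
    have "0 \<le> M' * real F" using cached[of 1, symmetric] K by simp
    then show "0 \<le> M" using F0 M(1) by (simp add: zero_le_mult_iff)
    show "M \<le> real N" by fact
    have "0 \<le> memory_sharing_rate N K M' * real F" unfolding rate by simp
    then show "0 \<le> memory_sharing_rate N K M'" using F0 by (simp add: zero_le_mult_iff)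
    show "real (N * card (labels ({1..K} - {u}) c)) \<le> M * real F" if "u \<in> {1..K}" for u
      unfolding cached[OF that] using M(1) by (intro mult_right_mono) auto
    show "real (card (labels {1..K} (c \<circ> Suc))) \<le> memory_sharing_rate N K M' * real F"
      by (simp add: rate)
  qed
qed

lemma memory_sharing_achievable_Rats:
  assumes N: "1 \<le> N" and K: "3 \<le> K" and "M' \<in> \<rat>"
    and lo: "real N / real K * (real K - 2) \<le> M'" and hi: "M' \<le> real N / real K * (real K - 1)"
    and M: "M' \<le> M" "M \<le> real N"
  shows "achievable N K M (memory_sharing_rate N K M')"
proof -
  \<comment> \<open>The fraction of each file to be missing from two caches, solved from
    \<open>M' = N * (K - 1 - \<alpha>) / K\<close>; written as \<open>p / (p + r)\<close> it gives
    the weights.\<close>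
  define \<alpha> where "\<alpha> = real K - 1 - real K * M' / real N"
  have "\<alpha> \<in> \<rat>"
    unfolding \<alpha>_def using assms(3) by simp
  then obtain p q :: nat where pq: "q \<noteq> 0" "\<bar>\<alpha>\<bar> = real p / real q"
    by (rule Rats_abs_nat_div_natE)
  have bounds: "0 \<le> \<alpha>" "\<alpha> \<le> 1"
    using lo hi N K by (auto simp: \<alpha>_def field_simps)
  then have \<alpha>: "\<alpha> = real p / real q"
    using pq by simp
  then have "p \<le> q"
    using bounds(2) pq(1) by (simp add: divide_le_eq_1)
  then obtain r where r: "q = p + r"
    using le_Suc_ex by blast
  have "real K * M' / real N = real K - 1 - real p / real q"
    using \<alpha> by (simp add: \<alpha>_def)
  then have "M' = real N / real K * (real K - 1 - real p / real q)"
    using N K by (simp add: field_simps)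
  also have "real K - 1 - real p / real q = ((real K - 1) * real q - real p) / real q"
    using pq(1) by (simp add: diff_divide_distrib)
  finally have "M' = real N * ((real K - 1) * real (p + r) - real p) / (real K * real (p + r))"
    by (simp add: r)
  then show ?thesis
    using memory_sharing_achievable[OF N K _ _ M] pq(1) r by simp
qed

text \<open>The range of \<open>M\<close> is the segment between the two schemes; at
  \<open>M = N\<close> the line would give a negative rate. For \<open>N = 1\<close>, identical
  caches with rate \<open>1 - M\<close> beat the line left of its right end; for
  \<open>N = K = 2\<close>, rate \<open>1\<close> at \<open>M = 1 / 2\<close> beats its value
  \<open>5 / 4\<close>. Attainment is stated for rational \<open>M\<close>, since an irrational
  cache size cannot be filled exactly.\<close>

theorem theorem5:
  fixes N K :: nat and M :: real
  assumes "2 \<le> N" and "int N \<le> \<lfloor>(real K + 1) / 2\<rfloor>"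
    and "real N / real K * (real K - 2) \<le> M"
    and "M \<le> real N / real K * (real K - 1)"
  shows "exact_rate N K M =
           ((real K)\<^sup>2 + real K - 2) / (real K * (real K - 1))
           - (real K + 1) / (real N * (real K - 1)) * M
         \<and> (M \<in> \<rat> \<longrightarrow> achievable N K M (exact_rate N K M))"
proof -
  have "real N \<le> (real K + 1) / 2"
    using assms(2) by (simp add: le_floor_iff)
  then have NK: "2 * N \<le> K + 1" by simp
  then have K: "3 \<le> K" "N \<le> K" and N: "1 \<le> N" using assms(1) by simp_all
  have "real N / real K * (real K - 1) \<le> real N"
    using K by (simp add: field_simps)
  then have MN: "M \<le> real N" using assms(4) by simp
  have lower: "memory_sharing_rate N K M \<le> R" if achievable: "achievable N K M R" for R
  proof -
    obtain F and Z :: "nat \<Rightarrow> files \<Rightarrow> bool list" and X :: "demand \<Rightarrow> files \<Rightarrow> bool list"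
      where "caching_scheme N K M R F Z X" "symmetric_scheme N K F Z X"
      using achievable unfolding achievable_def by blast
    then interpret sc: symmetric_caching N K M R F Z X
      using assms(1) K by unfold_locales
    show ?thesis
      using sc.rate_lower_bound[OF NK] by (simp add: memory_sharing_rate_def)
  qed
  have attained: "achievable N K M (memory_sharing_rate N K M)" if "M \<in> \<rat>"
    using memory_sharing_achievable_Rats[OF N K(1) that assms(3,4) order.refl MN] .
  define s where "s = (real K + 1) / (real N * (real K - 1))"
  have s: "s > 0" using N K by (simp add: s_def)
  have approx: "\<exists>R \<le> memory_sharing_rate N K M + e. achievable N K M R" if e: "e > 0" for e
  proof (cases "M \<in> \<rat>")
    case True
    then show ?thesis
      using attained e by (intro exI[of _ "memory_sharing_rate N K M"]) simp
  next
    case False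
    \<comment> \<open>The left end is rational, so an irrational \<open>M\<close> exceeds it and a
      rational \<open>M'\<close> fits in between. The line has slope \<open>- s\<close>, so
      \<open>M'\<close> within \<open>e / s\<close> of \<open>M\<close> costs at most
      \<open>e\<close> in rate.\<close>
    let ?lo = "real N / real K * (real K - 2)"
    have "?lo \<in> \<rat>" by simp
    then have "?lo < M" using False assms(3) by (metis order_le_less)
    then have "max ?lo (M - e / s) < M" using e s by simp
    then obtain M' where M': "M' \<in> \<rat>" "max ?lo (M - e / s) < M'" "M' < M"
      using Rats_dense_in_real by blast
    have "achievable N K M (memory_sharing_rate N K M')"
      using M' assms(4) MN by (intro memory_sharing_achievable_Rats N K(1)) auto
    moreover have "memory_sharing_rate N K M' = memory_sharing_rate N K M + s * (M - M')"
      by (simp add: memory_sharing_rate_def s_def right_diff_distrib)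
    moreover have "s * (M - M') \<le> e"
    proof -
      have "M - M' \<le> e / s" using M'(2) by simp
      then show ?thesis using s by (simp add: pos_le_divide_eq mult.commute)
    qed
    ultimately show ?thesis
      by (intro exI[of _ "memory_sharing_rate N K M'"]) simp
  qed
  have "exact_rate N K M = memory_sharing_rate N K M"
  proof (rule antisym)
    show "memory_sharing_rate N K M \<le> exact_rate N K M"
      unfolding exact_rate_def using approx[of 1] lower by (intro cInf_greatest) auto
    show "exact_rate N K M \<le> memory_sharing_rate N K M"
    proof (rule field_le_epsilon)
      fix e :: real assume "e > 0"
      then obtain R where R: "R \<le> memory_sharing_rate N K M + e" "achievable N K M R"
        using approx by blast
      have "exact_rate N K M \<le> R"
        unfolding exact_rate_def using R(2) lower by (intro cInf_lower bdd_belowI) auto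
      then show "exact_rate N K M \<le> memory_sharing_rate N K M + e" using R(1) by simp
    qed
  qed
  then show ?thesis
    using attained by (simp add: memory_sharing_rate_def)
qed

end
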